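(* Let $e_0,e_3,e_4\in\mathbb{C}^*$ satisfy $e_0\neq\pm1$, $e_3\neq\pm1$, $e_4\neq\pm1$ and $e_0e_3^{\varepsilon_3}e_4^{\varepsilon_4}\neq1$ for all $\varepsilon_3,\varepsilon_4\in\{1,-1\}$, and let $\mathcal{C}_V(\theta)$ be the associated cubic surface. Let $\mathrm{Conf}^\sharp(P_V)$ be the extended confluent dynamics and $\mathrm{Dyn}^\sharp(\mathcal{C}_V)$ the extended canonical dynamics, both subgroups of the group of birational self-maps of $\mathcal{C}_V(\theta)$ (all defined in the context). Then $$\mathrm{Conf}^\sharp(P_V)=\mathrm{Dyn}^\sharp(\mathcal{C}_V).$$
   Context: Cubic surface. $a_3=e_3+e_3^{-1}$, $a_4=e_4+e_4^{-1}$, $\theta_1=a_3+e_0a_4$, $\theta_2=a_4+e_0a_3$, $\theta_3=e_0$, $\theta_4=e_0^2+e_0a_3a_4+1$; $\mathcal{C}_V(\theta)\subset\mathbb{C}^3$ is the surface $F_V=x_1x_2x_3+x_1^2+x_2^2-\theta_1x_1-\theta_2x_2-\theta_3x_3+\theta_4=0$. Conventions. For a rational map $f$ and a function $u$, $f^*u=u\circ f$. If $(u,v)$ is a pair of rational functions giving a birational map $\mathcal{C}_V(\theta)\to\mathbb{C}^2$, then writing $f:(u,v)\mapsto(A(u,v),B(u,v))$ means $f^*u=A(u,v)$, $f^*v=B(u,v)$; this determines $f$. $\langle\cdots\rangle$ denotes the generated subgroup. Canonical sequence. On $\mathcal{C}_V(\theta)$ let $\sigma_1(x_1,x_2,x_3)=(-x_1-x_2x_3+\theta_1,x_2,x_3)$,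 $\sigma_2(x_1,x_2,x_3)=(x_1,-x_2-x_1x_3+\theta_2,x_3)$, $g=\sigma_1\circ\sigma_2$. Let $y_1=x_1$, $z_1=x_1x_2-e_0$, $y_2=x_2$, $z_2=\sigma_1^*z_1$, $y_3=\sigma_1^*y_1$. The pairs $(y_1,z_1)$, $(z_1,y_2)$, $(y_2,z_2)$ are birational coordinates on $\mathcal{C}_V(\theta)$. Canonical dynamics. $T_{y_1}=\{(y_1,z_1)\mapsto(y_1,\lambda z_1):\lambda\in\mathbb{C}^*\}$; for $k=1,2$, $s_k:(y_k,z_k)\mapsto(y_k(1+e_0^{-1}z_k),z_k)$. $\mathrm{Dyn}(\mathcal{C}_V)=\langle g,T_{y_1},s_1,s_2\rangle$. Let $\widehat m^{1/2}$ be the map $(y_2,z_2)\mapsto(y_2,e_0^{-1}y_2^2z_2)$, and $\mathrm{Dyn}^\sharp(\mathcal{C}_V)=\langle \mathrm{Dyn}(\mathcal{C}_V),\widehat m^{1/2}\rangle$. Confluent dynamics. For $\kappa\in\mathbb{C}^*$ put $b_1=\kappa+\kappa^{-1}$, $b_2=e_0\kappa^{-1}+e_0^{-1}\kappa$, $b_3=a_3$, $b_4=a_4$, $\Theta_i=b_ib_4+b_jb_k$ for $\{i,j,k\}=\{1,2,3\}$, $\Theta_4=b_1b_2b_3b_4+\sum_{i=1}^4b_i^2-4$, and let $\mathcal{C}_{VI}(\theta_\kappa)\subset\mathbb{C}^3$ be the surface $x_1x_2x_3+x_1^2+x_2^2+x_3^2-\Theta_1x_1-\Theta_2x_2-\Theta_3x_3+\Theta_4=0$.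 Let $\Phi_\kappa:\mathcal{C}_V(\theta)\to\mathcal{C}_{VI}(\theta_\kappa)$ be the birational map $$(x_1,x_2,x_3)\mapsto\big(e_0^{-1}\kappa x_1+\kappa^{-1}x_2,\; -e_0^{-1}\kappa x_1x_3+\kappa^{-1}x_1-e_0^{-1}\kappa x_2+a_3\kappa+a_4e_0^{-1}\kappa,\; x_3\big).$$ For $(i,j,k)\in\{(1,2,3),(2,3,1),(3,1,2)\}$ let $h_{i,j}$ be the automorphism of $\mathcal{C}_{VI}(\theta_\kappa)$ given by $x_i\mapsto -x_i+x_jx_k+x_ix_k^2-\Theta_jx_k+\Theta_i$, $x_j\mapsto -x_j-x_ix_k+\Theta_j$, $x_k\mapsto x_k$. $\mathrm{Conf}(P_V)$ is the group generated by all $\Phi_\kappa^{-1}\circ h_{i,j}\circ\Phi_\kappa$, $\kappa\in\mathbb{C}^*$, $(i,j)\in\{(1,2),(2,3),(3,1)\}$. $\mathrm{Conf}^\sharp(P_V)$ is the group generated by $\mathrm{Conf}(P_V)$ and the map $(z_1,y_2)\mapsto(z_1y_2^2,y_2)$. *)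

theory Defs
  imports Complex_Main "HOL-Algebra.Generated_Groups"
begin

type_synonym point = "complex \<times> complex \<times> complex"

section \<open>Rational maps between (irreducible) closed subsets of affine 3-space\<close>

inductive_set poly_fun :: "(point \<Rightarrow> complex) set" where
  const: "(\<lambda>_. c) \<in> poly_fun"
| coord1: "(\<lambda>(x1, x2, x3). x1) \<in> poly_fun"
| coord2: "(\<lambda>(x1, x2, x3). x2) \<in> poly_fun"
| coord3: "(\<lambda>(x1, x2, x3). x3) \<in> poly_fun"
| add: "p \<in> poly_fun \<Longrightarrow> q \<in> poly_fun \<Longrightarrow> (\<lambda>x. p x + q x) \<in> poly_fun"
| mult: "p \<in> poly_fun \<Longrightarrow> q \<in> poly_fun \<Longrightarrow> (\<lambda>x. p x * q x) \<in> poly_fun"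

text \<open>The polynomial \<open>q\<close> defines a Zariski-dense principal open subset
  \<open>{x \<in> S. q x \<noteq> 0}\<close> of \<open>S\<close>.  For a nonempty irreducible \<open>S\<close> this just says that
  \<open>q\<close> does not vanish identically on \<open>S\<close>.\<close>

definition admissible_denominator :: "point set \<Rightarrow> (point \<Rightarrow> complex) \<Rightarrow> bool" where
  "admissible_denominator S q \<longleftrightarrow> q \<in> poly_fun \<and>
     (\<forall>p\<in>poly_fun. (\<forall>x\<in>S. q x \<noteq> 0 \<longrightarrow> p x = 0) \<longrightarrow> (\<forall>x\<in>S. p x = 0))"

definition generically :: "point set \<Rightarrow> (point \<Rightarrow> bool) \<Rightarrow> bool" where
  "generically S P \<longleftrightarrow> (\<exists>q. admissible_denominator S q \<and> (\<forall>x\<in>S. q x \<noteq> 0 \<longrightarrow> P x))"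

text \<open>Rational functions and rational maps are represented by total functions, whose values
  matter only on a dense Zariski-open subset; two total functions represent the same rational
  map on \<open>S\<close> iff they agree generically on \<open>S\<close>.\<close>

definition rational_function :: "point set \<Rightarrow> (point \<Rightarrow> complex) \<Rightarrow> bool" where
  "rational_function S u \<longleftrightarrow> (\<exists>p q. p \<in> poly_fun \<and> admissible_denominator S q \<and>
     generically S (\<lambda>x. u x = p x / q x))"

definition rational_map :: "point set \<Rightarrow> point set \<Rightarrow> (point \<Rightarrow> point) \<Rightarrow> bool" where
  "rational_map S S' f \<longleftrightarrow>
     rational_function S (\<lambda>x. fst (f x)) \<and>
     rational_function S (\<lambda>x. fst (snd (f x))) \<and>
     rational_function S (\<lambda>x. snd (snd (f x))) \<and>
     generically S (\<lambda>x. f x \<in> S')"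

text \<open>Dominance: a polynomial that vanishes on the image of \<open>f\<close> vanishes on \<open>S'\<close>.\<close>

definition dominant :: "point set \<Rightarrow> point set \<Rightarrow> (point \<Rightarrow> point) \<Rightarrow> bool" where
  "dominant S S' f \<longleftrightarrow>
     (\<forall>p\<in>poly_fun. generically S (\<lambda>x. p (f x) = 0) \<longrightarrow> (\<forall>y\<in>S'. p y = 0))"

definition birational_inverse ::
    "point set \<Rightarrow> point set \<Rightarrow> (point \<Rightarrow> point) \<Rightarrow> (point \<Rightarrow> point) \<Rightarrow> bool" where
  "birational_inverse S S' f g \<longleftrightarrow>
     rational_map S S' f \<and> dominant S S' f \<and>
     rational_map S' S g \<and> dominant S' S g \<and>
     generically S (\<lambda>x. g (f x) = x) \<and> generically S' (\<lambda>y. f (g y) = y)"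

definition birational :: "point set \<Rightarrow> point set \<Rightarrow> (point \<Rightarrow> point) \<Rightarrow> bool" where
  "birational S S' f \<longleftrightarrow> (\<exists>g. birational_inverse S S' f g)"

text \<open>A representative of the inverse; it is unique up to generic equality on \<open>S'\<close>.\<close>

definition inverse_map :: "point set \<Rightarrow> point set \<Rightarrow> (point \<Rightarrow> point) \<Rightarrow> (point \<Rightarrow> point)" where
  "inverse_map S S' f = (SOME g. birational_inverse S S' f g)"

definition map_class :: "point set \<Rightarrow> (point \<Rightarrow> point) \<Rightarrow> (point \<Rightarrow> point) set" where
  "map_class S f = {g. generically S (\<lambda>x. g x = f x)}"

text \<open>The group of birational self-maps of \<open>S\<close> under composition.\<close>

definition Bir :: "point set \<Rightarrow> (point \<Rightarrow> point) set monoid" where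
  "Bir S = \<lparr>carrier = {map_class S f |f. birational S S f},
            monoid.mult = (\<lambda>F G. \<Union>f\<in>F. \<Union>g\<in>G. map_class S (f \<circ> g)),
            one = map_class S id\<rparr>"

text \<open>The birational self-map written \<open>(u, v) \<mapsto> (A(u, v), B(u, v))\<close>, where \<open>(u, v)\<close> are
  birational coordinates on \<open>S\<close>: the map whose pull-back sends \<open>u\<close> to \<open>A(u, v)\<close>
  and \<open>v\<close> to \<open>B(u, v)\<close>.\<close>

definition map_in_coords ::
    "point set \<Rightarrow> (point \<Rightarrow> complex) \<Rightarrow> (point \<Rightarrow> complex) \<Rightarrow>
     (complex \<Rightarrow> complex \<Rightarrow> complex \<times> complex) \<Rightarrow> (point \<Rightarrow> point) set" where
  "map_in_coords S u v AB = (THE F. F \<in> carrier (Bir S) \<and>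
     (\<forall>f\<in>F. generically S (\<lambda>x. (u (f x), v (f x)) = AB (u x) (v x))))"


section \<open>The cubic surface \<open>C\<^sub>V(\<theta>)\<close> and its canonical dynamics\<close>

definition par :: "complex \<Rightarrow> complex" where
  "par e = e + inverse e"

definition theta1 :: "complex \<Rightarrow> complex \<Rightarrow> complex \<Rightarrow> complex" where
  "theta1 e0 e3 e4 = par e3 + e0 * par e4"

definition theta2 :: "complex \<Rightarrow> complex \<Rightarrow> complex \<Rightarrow> complex" where
  "theta2 e0 e3 e4 = par e4 + e0 * par e3"

definition theta3 :: "complex \<Rightarrow> complex \<Rightarrow> complex \<Rightarrow> complex" where
  "theta3 e0 e3 e4 = e0"

definition theta4 :: "complex \<Rightarrow> complex \<Rightarrow> complex \<Rightarrow> complex" where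
  "theta4 e0 e3 e4 = e0^2 + e0 * par e3 * par e4 + 1"

definition CV :: "complex \<Rightarrow> complex \<Rightarrow> complex \<Rightarrow> point set" where
  "CV e0 e3 e4 = {(x1, x2, x3). x1 * x2 * x3 + x1^2 + x2^2 - theta1 e0 e3 e4 * x1
     - theta2 e0 e3 e4 * x2 - theta3 e0 e3 e4 * x3 + theta4 e0 e3 e4 = 0}"

definition sigma1 :: "complex \<Rightarrow> complex \<Rightarrow> complex \<Rightarrow> point \<Rightarrow> point" where
  "sigma1 e0 e3 e4 = (\<lambda>(x1, x2, x3). (- x1 - x2 * x3 + theta1 e0 e3 e4, x2, x3))"

definition sigma2 :: "complex \<Rightarrow> complex \<Rightarrow> complex \<Rightarrow> point \<Rightarrow> point" where
  "sigma2 e0 e3 e4 = (\<lambda>(x1, x2, x3). (x1, - x2 - x1 * x3 + theta2 e0 e3 e4, x3))"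

definition y1 :: "point \<Rightarrow> complex" where
  "y1 = (\<lambda>(x1, x2, x3). x1)"

definition z1 :: "complex \<Rightarrow> point \<Rightarrow> complex" where
  "z1 e0 = (\<lambda>(x1, x2, x3). x1 * x2 - e0)"

definition y2 :: "point \<Rightarrow> complex" where
  "y2 = (\<lambda>(x1, x2, x3). x2)"

definition z2 :: "complex \<Rightarrow> complex \<Rightarrow> complex \<Rightarrow> point \<Rightarrow> complex" where
  "z2 e0 e3 e4 = z1 e0 \<circ> sigma1 e0 e3 e4"

definition g_map :: "complex \<Rightarrow> complex \<Rightarrow> complex \<Rightarrow> (point \<Rightarrow> point) set" where
  "g_map e0 e3 e4 = map_class (CV e0 e3 e4) (sigma1 e0 e3 e4 \<circ> sigma2 e0 e3 e4)"

definition T_y1 :: "complex \<Rightarrow> complex \<Rightarrow> complex \<Rightarrow> (point \<Rightarrow> point) set set" where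
  "T_y1 e0 e3 e4 =
     {map_in_coords (CV e0 e3 e4) y1 (z1 e0) (\<lambda>y z. (y, l * z)) |l. l \<noteq> 0}"

definition s1 :: "complex \<Rightarrow> complex \<Rightarrow> complex \<Rightarrow> (point \<Rightarrow> point) set" where
  "s1 e0 e3 e4 = map_in_coords (CV e0 e3 e4) y1 (z1 e0)
     (\<lambda>y z. (y * (1 + inverse e0 * z), z))"

definition s2 :: "complex \<Rightarrow> complex \<Rightarrow> complex \<Rightarrow> (point \<Rightarrow> point) set" where
  "s2 e0 e3 e4 = map_in_coords (CV e0 e3 e4) y2 (z2 e0 e3 e4)
     (\<lambda>y z. (y * (1 + inverse e0 * z), z))"

definition Dyn :: "complex \<Rightarrow> complex \<Rightarrow> complex \<Rightarrow> (point \<Rightarrow> point) set set" where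
  "Dyn e0 e3 e4 = generate (Bir (CV e0 e3 e4))
     ({g_map e0 e3 e4} \<union> T_y1 e0 e3 e4 \<union> {s1 e0 e3 e4, s2 e0 e3 e4})"

definition m_half :: "complex \<Rightarrow> complex \<Rightarrow> complex \<Rightarrow> (point \<Rightarrow> point) set" where
  "m_half e0 e3 e4 = map_in_coords (CV e0 e3 e4) y2 (z2 e0 e3 e4)
     (\<lambda>y z. (y, inverse e0 * y^2 * z))"

definition Dyn_sharp :: "complex \<Rightarrow> complex \<Rightarrow> complex \<Rightarrow> (point \<Rightarrow> point) set set" where
  "Dyn_sharp e0 e3 e4 = generate (Bir (CV e0 e3 e4)) (Dyn e0 e3 e4 \<union> {m_half e0 e3 e4})"


section \<open>The cubic surfaces \<open>C\<^sub>V\<^sub>I(\<theta>\<^sub>\<kappa>)\<close> and the confluent dynamics\<close>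

text \<open>Throughout, \<open>k\<close> is the parameter \<open>\<kappa>\<close>.\<close>

definition b1 :: "complex \<Rightarrow> complex" where
  "b1 k = k + inverse k"

definition b2 :: "complex \<Rightarrow> complex \<Rightarrow> complex" where
  "b2 e0 k = e0 * inverse k + inverse e0 * k"

definition Theta1 :: "complex \<Rightarrow> complex \<Rightarrow> complex \<Rightarrow> complex \<Rightarrow> complex" where
  "Theta1 e0 e3 e4 k = b1 k * par e4 + b2 e0 k * par e3"

definition Theta2 :: "complex \<Rightarrow> complex \<Rightarrow> complex \<Rightarrow> complex \<Rightarrow> complex" where
  "Theta2 e0 e3 e4 k = b2 e0 k * par e4 + par e3 * b1 k"

definition Theta3 :: "complex \<Rightarrow> complex \<Rightarrow> complex \<Rightarrow> complex \<Rightarrow> complex" where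
  "Theta3 e0 e3 e4 k = par e3 * par e4 + b1 k * b2 e0 k"

definition Theta4 :: "complex \<Rightarrow> complex \<Rightarrow> complex \<Rightarrow> complex \<Rightarrow> complex" where
  "Theta4 e0 e3 e4 k = b1 k * b2 e0 k * par e3 * par e4
     + ((b1 k)^2 + (b2 e0 k)^2 + (par e3)^2 + (par e4)^2) - 4"

definition CVI :: "complex \<Rightarrow> complex \<Rightarrow> complex \<Rightarrow> complex \<Rightarrow> point set" where
  "CVI e0 e3 e4 k = {(x1, x2, x3). x1 * x2 * x3 + x1^2 + x2^2 + x3^2
     - Theta1 e0 e3 e4 k * x1 - Theta2 e0 e3 e4 k * x2 - Theta3 e0 e3 e4 k * x3
     + Theta4 e0 e3 e4 k = 0}"

definition Phi :: "complex \<Rightarrow> complex \<Rightarrow> complex \<Rightarrow> complex \<Rightarrow> point \<Rightarrow> point" where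
  "Phi e0 e3 e4 k = (\<lambda>(x1, x2, x3).
     (inverse e0 * k * x1 + inverse k * x2,
      - inverse e0 * k * x1 * x3 + inverse k * x1 - inverse e0 * k * x2
        + par e3 * k + par e4 * inverse e0 * k,
      x3))"

definition h12 :: "complex \<Rightarrow> complex \<Rightarrow> complex \<Rightarrow> complex \<Rightarrow> point \<Rightarrow> point" where
  "h12 e0 e3 e4 k = (\<lambda>(x1, x2, x3).
     (- x1 + x2 * x3 + x1 * x3^2 - Theta2 e0 e3 e4 k * x3 + Theta1 e0 e3 e4 k,
      - x2 - x1 * x3 + Theta2 e0 e3 e4 k,
      x3))"

definition h23 :: "complex \<Rightarrow> complex \<Rightarrow> complex \<Rightarrow> complex \<Rightarrow> point \<Rightarrow> point" where
  "h23 e0 e3 e4 k = (\<lambda>(x1, x2, x3).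
     (x1,
      - x2 + x3 * x1 + x2 * x1^2 - Theta3 e0 e3 e4 k * x1 + Theta2 e0 e3 e4 k,
      - x3 - x2 * x1 + Theta3 e0 e3 e4 k))"

definition h31 :: "complex \<Rightarrow> complex \<Rightarrow> complex \<Rightarrow> complex \<Rightarrow> point \<Rightarrow> point" where
  "h31 e0 e3 e4 k = (\<lambda>(x1, x2, x3).
     (- x1 - x3 * x2 + Theta1 e0 e3 e4 k,
      x2,
      - x3 + x1 * x2 + x3 * x2^2 - Theta1 e0 e3 e4 k * x2 + Theta3 e0 e3 e4 k))"

definition conj_Phi ::
    "complex \<Rightarrow> complex \<Rightarrow> complex \<Rightarrow> complex \<Rightarrow> (point \<Rightarrow> point) \<Rightarrow> (point \<Rightarrow> point) set" where
  "conj_Phi e0 e3 e4 k h = map_class (CV e0 e3 e4)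
     (inverse_map (CV e0 e3 e4) (CVI e0 e3 e4 k) (Phi e0 e3 e4 k) \<circ> h \<circ> Phi e0 e3 e4 k)"

definition Conf :: "complex \<Rightarrow> complex \<Rightarrow> complex \<Rightarrow> (point \<Rightarrow> point) set set" where
  "Conf e0 e3 e4 = generate (Bir (CV e0 e3 e4))
     {conj_Phi e0 e3 e4 k h |k h. k \<noteq> 0 \<and> h \<in> {h12 e0 e3 e4 k, h23 e0 e3 e4 k, h31 e0 e3 e4 k}}"

definition Conf_sharp :: "complex \<Rightarrow> complex \<Rightarrow> complex \<Rightarrow> (point \<Rightarrow> point) set set" where
  "Conf_sharp e0 e3 e4 = generate (Bir (CV e0 e3 e4))
     (Conf e0 e3 e4 \<union>
      {map_in_coords (CV e0 e3 e4) (z1 e0) y2 (\<lambda>z y. (z * y^2, y))})"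

end

theory Submission
  imports Defs "HOL-Computational_Algebra.Polynomial"
begin

text \<open>Write \<open>(a, b)\<close> for the first two coordinates and \<open>z = a b - e\<^sub>0\<close>.  The equation of the surface
  is linear in \<open>x\<^sub>3\<close> with coefficient \<open>z\<close>, so \<open>(a, b)\<close> is a birational chart, and every generator
  has an explicit formula in it:
  \<^item> the torus \<open>t\<^sub>\<lambda>\<close> fixes \<open>a\<close> and multiplies \<open>z\<close> by \<open>\<lambda>\<close>;
  \<^item> \<open>s\<^sub>1\<close> is \<open>(a, b) \<mapsto> (a\<^sup>2 b / e\<^sub>0, e\<^sub>0 / a)\<close> and fixes \<open>z\<close>;
  \<^item> since \<open>z\<^sub>1 z\<^sub>2\<close> is a polynomial in \<open>b\<close> alone, multiplying \<open>z\<^sub>2\<close> by a function of \<open>b\<close> means dividing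
    \<open>z\<^sub>1\<close> by it; so \<open>m\<close> (the map \<open>m_half\<close>), the extra generator \<open>M\<close> of the confluent group, and the
    torus \<open>u\<^sub>\<lambda>\<close> fixing \<open>b\<close> all have the form \<open>z \<mapsto> c b\<^sup>n z\<close>, with \<open>(c, n)\<close> equal to \<open>(e\<^sub>0, -2)\<close>,
    \<open>(1, 2)\<close> and \<open>(\<lambda>, 0)\<close>.

  Put \<open>w\<^sub>\<kappa> = t\<^sub>\<mu> s\<^sub>1\<inverse> m\<close> with \<open>\<mu> = \<kappa>\<^sup>2 / e\<^sub>0\<close>.  The heart of the matter is that conjugation by
  \<open>\<Phi>\<^sub>\<kappa>\<close> turns \<open>h\<^sub>1\<^sub>2\<close>, \<open>h\<^sub>2\<^sub>3\<close>, \<open>h\<^sub>3\<^sub>1\<close> into \<open>g\<inverse>\<close>, \<open>w\<^sub>\<kappa>\<inverse>\<close>, \<open>w\<^sub>\<kappa> g\<close>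
  (\<open>conj_h12\<close>, \<open>conj_h23\<close>, \<open>conj_h31\<close>; the third follows from the other two because the three
  maps compose to the identity).  Together with the relations \<open>s\<^sub>1 t\<^sub>\<lambda> s\<^sub>1\<inverse> = u\<^sub>\<lambda>\<close>, \<open>m u\<^sub>\<lambda> = u\<^sub>\<lambda> m\<close>,
  \<open>M m = u\<^sub>\<lambda>\<close> for \<open>\<lambda> = e\<^sub>0\<close>, and \<open>s\<^sub>2 = g s\<^sub>1\<inverse> m m\<close>, the theorem becomes pure group theory
  (\<open>torus_generation\<close>).  The canonical generators visibly produce \<open>w\<^sub>\<kappa>\<close> and \<open>M\<close>.  Conversely
  \<open>w\<^sub>\<kappa> w\<^sub>\<nu>\<inverse>\<close> runs through all \<open>t\<^sub>\<lambda>\<close>; hence \<open>r = s\<^sub>1\<inverse> m\<close> lies in the confluent group, so does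
  \<open>r\<inverse> t\<^sub>\<lambda> r = u\<^sub>\<lambda>\<close>, then \<open>m\<close> by means of \<open>M\<close>, and finally \<open>s\<^sub>1\<close> and \<open>s\<^sub>2\<close>.

  What makes these identities of formulas into identities of birational maps is the irreducibility
  of both surfaces: a nonzero polynomial function is then an admissible denominator, and classes of
  birational maps form a group.  Each surface is monic quadratic in \<open>x\<^sub>1\<close>, so its points move
  continuously with \<open>(x\<^sub>2, x\<^sub>3)\<close> and the domain of the chart, respectively the image of \<open>\<Phi>\<^sub>\<kappa>\<close>, is dense; two
  points in the domain of the chart lie on a rational curve, the lift of a line.\<close>

section \<open>Polynomial functions and irreducible sets\<close>

lemma poly_fun_fst: "fst \<in> poly_fun"
proof -
  have "(fst :: point \<Rightarrow> complex) = (\<lambda>(x1, x2, x3). x1)" by (auto simp: fun_eq_iff)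
  then show ?thesis using poly_fun.coord1 by (simp only:)
qed

lemma poly_fun_fst_snd: "(\<lambda>x. fst (snd x)) \<in> poly_fun"
proof -
  have "(\<lambda>x::point. fst (snd x)) = (\<lambda>(x1, x2, x3). x2)" by (auto simp: fun_eq_iff)
  then show ?thesis using poly_fun.coord2 by (simp only:)
qed

lemma poly_fun_snd_snd: "(\<lambda>x. snd (snd x)) \<in> poly_fun"
proof -
  have "(\<lambda>x::point. snd (snd x)) = (\<lambda>(x1, x2, x3). x3)" by (auto simp: fun_eq_iff)
  then show ?thesis using poly_fun.coord3 by (simp only:)
qed

lemma poly_fun_uminus: "p \<in> poly_fun \<Longrightarrow> (\<lambda>x. - p x) \<in> poly_fun"
  using poly_fun.mult[OF poly_fun.const[of "-1"], of p] by simp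

lemma poly_fun_diff: "p \<in> poly_fun \<Longrightarrow> q \<in> poly_fun \<Longrightarrow> (\<lambda>x. p x - q x) \<in> poly_fun"
  using poly_fun.add[OF _ poly_fun_uminus, of p q] by simp

lemma poly_fun_power: "p \<in> poly_fun \<Longrightarrow> (\<lambda>x. p x ^ n) \<in> poly_fun"
  by (induction n) (auto intro: poly_fun.intros)

lemmas poly_fun_intros = poly_fun.const poly_fun.add poly_fun.mult poly_fun_fst
  poly_fun_fst_snd poly_fun_snd_snd poly_fun_uminus poly_fun_diff poly_fun_power

lemma poly_fun_comp:
  assumes "p \<in> poly_fun" "(\<lambda>x. fst (f x)) \<in> poly_fun" "(\<lambda>x. fst (snd (f x))) \<in> poly_fun"
    "(\<lambda>x. snd (snd (f x))) \<in> poly_fun"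
  shows "(\<lambda>x. p (f x)) \<in> poly_fun"
  using assms(1)
proof induction
  case coord1 then show ?case using assms by (simp add: case_prod_unfold)
next
  case coord2 then show ?case using assms by (simp add: case_prod_unfold)
next
  case coord3 then show ?case using assms by (simp add: case_prod_unfold)
qed (auto intro: poly_fun.intros)

lemma admissible_denominatorD:
  assumes "admissible_denominator S q"
  shows "q \<in> poly_fun"
    and "p \<in> poly_fun \<Longrightarrow> (\<And>x. x \<in> S \<Longrightarrow> q x \<noteq> 0 \<Longrightarrow> p x = 0) \<Longrightarrow> x \<in> S \<Longrightarrow> p x = 0"
  using assms by (simp_all add: admissible_denominator_def)

text \<open>Phrased as primality of the vanishing ideal among polynomial functions, which is the form in
  which irreducibility is used: it makes rational functions on \<open>S\<close> a field.\<close>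

definition irreducible_set :: "point set \<Rightarrow> bool" where
  "irreducible_set S \<longleftrightarrow> S \<noteq> {} \<and>
     (\<forall>p\<in>poly_fun. \<forall>q\<in>poly_fun. (\<forall>x\<in>S. p x * q x = 0) \<longrightarrow>
        (\<forall>x\<in>S. p x = 0) \<or> (\<forall>x\<in>S. q x = 0))"

lemma irreducible_setD:
  assumes "irreducible_set S" "p \<in> poly_fun" "q \<in> poly_fun" "\<And>x. x \<in> S \<Longrightarrow> p x * q x = 0"
  shows "(\<forall>x\<in>S. p x = 0) \<or> (\<forall>x\<in>S. q x = 0)"
  using assms by (simp add: irreducible_set_def)

lemma admissible_denominator_iff:
  assumes "irreducible_set S"
  shows "admissible_denominator S q \<longleftrightarrow> q \<in> poly_fun \<and> (\<exists>x\<in>S. q x \<noteq> 0)"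
proof
  assume q: "admissible_denominator S q"
  have "S \<noteq> {}" using assms by (simp add: irreducible_set_def)
  then show "q \<in> poly_fun \<and> (\<exists>x\<in>S. q x \<noteq> 0)"
    using admissible_denominatorD(1)[OF q] admissible_denominatorD(2)[OF q poly_fun.const[of 1]]
    by auto
next
  assume q: "q \<in> poly_fun \<and> (\<exists>x\<in>S. q x \<noteq> 0)"
  have "\<forall>x\<in>S. p x = 0" if p: "p \<in> poly_fun" "\<forall>x\<in>S. q x \<noteq> 0 \<longrightarrow> p x = 0" for p
    using irreducible_setD[OF assms, of q p] p q by auto
  then show "admissible_denominator S q" using q by (simp add: admissible_denominator_def)
qed

lemma genericallyI:
  assumes "irreducible_set S" "q \<in> poly_fun" "x0 \<in> S" "q x0 \<noteq> 0"
    and "\<And>x. x \<in> S \<Longrightarrow> q x \<noteq> 0 \<Longrightarrow> P x"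
  shows "generically S P"
proof -
  have "admissible_denominator S q" using assms by (auto simp: admissible_denominator_iff)
  then show ?thesis using assms(5) by (auto simp: generically_def)
qed

lemma generically_mono:
  "generically S P \<Longrightarrow> (\<And>x. x \<in> S \<Longrightarrow> P x \<Longrightarrow> Q x) \<Longrightarrow> generically S Q"
  unfolding generically_def by blast

lemma generically_everywhere: "(\<And>x. x \<in> S \<Longrightarrow> P x) \<Longrightarrow> generically S P"
  unfolding generically_def admissible_denominator_def
  by (intro exI[of _ "\<lambda>_. 1"]) (auto intro: poly_fun.const)

lemma admissible_denominator_mult:
  assumes q: "admissible_denominator S q" and r: "admissible_denominator S r"
  shows "admissible_denominator S (\<lambda>x. q x * r x)"
  unfolding admissible_denominator_def
proof (intro conjI ballI impI)
  show "(\<lambda>x. q x * r x) \<in> poly_fun"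
    using q r by (auto simp: admissible_denominator_def intro: poly_fun.mult)
next
  fix p x assume p: "p \<in> poly_fun" "\<forall>x\<in>S. q x * r x \<noteq> 0 \<longrightarrow> p x = 0" and x: "x \<in> S"
  have pq: "(\<lambda>x. p x * q x) \<in> poly_fun"
    using p(1) admissible_denominatorD(1)[OF q] by (rule poly_fun.mult)
  have "p y * q y = 0" if "y \<in> S" for y
    by (rule admissible_denominatorD(2)[OF r pq _ that]) (use p in auto)
  then show "p x = 0" using admissible_denominatorD(2)[OF q p(1) _ x] by (metis mult_eq_0_iff)
qed

lemma generically_conj:
  assumes "generically S P" "generically S Q"
  shows "generically S (\<lambda>x. P x \<and> Q x)"
proof -
  obtain q r where "admissible_denominator S q" "\<forall>x\<in>S. q x \<noteq> 0 \<longrightarrow> P x"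
    "admissible_denominator S r" "\<forall>x\<in>S. r x \<noteq> 0 \<longrightarrow> Q x"
    using assms unfolding generically_def by blast
  then show ?thesis unfolding generically_def
    by (intro exI[of _ "\<lambda>x. q x * r x"]) (auto intro: admissible_denominator_mult)
qed

text \<open>Combines two generic facts and weakens the result; most generic identities below are
  pointwise identities away from the zeros of a few coordinates, and enter through this rule.\<close>

lemma generically_conj2:
  assumes "generically S P" "generically S Q" "\<And>x. x \<in> S \<Longrightarrow> P x \<Longrightarrow> Q x \<Longrightarrow> R x"
  shows "generically S R"
  using generically_mono[OF generically_conj[OF assms(1,2)]] assms(3) by blast

lemma generically_ex:
  assumes "irreducible_set S" "generically S P"
  obtains x where "x \<in> S" "P x"
  using assms admissible_denominator_iff[of S] unfolding generically_def by blast

lemma generically_nonzero: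
  assumes "irreducible_set S" "q \<in> poly_fun" "x \<in> S" "q x \<noteq> 0"
  shows "generically S (\<lambda>x. q x \<noteq> 0)"
  using genericallyI[OF assms] .

lemma generically_poly_zero:
  assumes "p \<in> poly_fun" "generically S (\<lambda>x. p x = 0)" "x \<in> S"
  shows "p x = 0"
  using assms admissible_denominatorD(2) unfolding generically_def by metis


section \<open>Rational functions\<close>

lemma rational_function_cong:
  assumes "rational_function S u" "generically S (\<lambda>x. u x = v x)"
  shows "rational_function S v"
proof -
  obtain p q where "p \<in> poly_fun" "admissible_denominator S q" 
    and g: "generically S (\<lambda>x. u x = p x / q x)"
    using assms(1) unfolding rational_function_def by blast
  moreover have "generically S (\<lambda>x. v x = p x / q x)"
    using g assms(2) by (rule generically_conj2) simp
  ultimately show ?thesis unfolding rational_function_def by blast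
qed

lemma rational_function_quotient:
  assumes "p \<in> poly_fun" "admissible_denominator S q"
  shows "rational_function S (\<lambda>x. p x / q x)"
  using assms generically_everywhere[of S "\<lambda>x. p x / q x = p x / q x"]
  unfolding rational_function_def by blast

lemma admissible_denominator_generically:
  "admissible_denominator S q \<Longrightarrow> generically S (\<lambda>x. q x \<noteq> 0)"
  unfolding generically_def by blast

lemma rational_function_poly:
  assumes "p \<in> poly_fun"
  shows "rational_function S p"
proof -
  have "admissible_denominator S (\<lambda>_. 1)"
    by (auto simp: admissible_denominator_def intro: poly_fun.const)
  from rational_function_quotient[OF assms this] show ?thesis by simp
qed

lemma rational_function_add:
  assumes "rational_function S u" "rational_function S v"
  shows "rational_function S (\<lambda>x. u x + v x)"
proof -
  obtain p q where 1: "p \<in> poly_fun" "admissible_denominator S q"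
    and g1: "generically S (\<lambda>x. u x = p x / q x)"
    using assms(1) unfolding rational_function_def by blast
  obtain p' q' where 2: "p' \<in> poly_fun" "admissible_denominator S q'"
    and g2: "generically S (\<lambda>x. v x = p' x / q' x)"
    using assms(2) unfolding rational_function_def by blast
  have qq: "q \<in> poly_fun" "q' \<in> poly_fun"
    using 1 2 by (auto simp: admissible_denominator_def)
  have "rational_function S (\<lambda>x. (p x * q' x + p' x * q x) / (q x * q' x))"
    by (rule rational_function_quotient)
       (use 1 2 qq in \<open>auto intro: poly_fun_intros admissible_denominator_mult\<close>)
  moreover have "generically S (\<lambda>x. q x * q' x \<noteq> 0)"
    using admissible_denominator_generically[OF admissible_denominator_mult] 1 2 by blast
  then have "generically S (\<lambda>x. (p x * q' x + p' x * q x) / (q x * q' x) = u x + v x)"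
    by (rule generically_conj2[OF _ generically_conj[OF g1 g2]]) (auto simp: field_simps)
  ultimately show ?thesis by (rule rational_function_cong)
qed

lemma rational_function_mult:
  assumes "rational_function S u" "rational_function S v"
  shows "rational_function S (\<lambda>x. u x * v x)"
proof -
  obtain p q where 1: "p \<in> poly_fun" "admissible_denominator S q"
    and g1: "generically S (\<lambda>x. u x = p x / q x)"
    using assms(1) unfolding rational_function_def by blast
  obtain p' q' where 2: "p' \<in> poly_fun" "admissible_denominator S q'"
    and g2: "generically S (\<lambda>x. v x = p' x / q' x)"
    using assms(2) unfolding rational_function_def by blast
  have "rational_function S (\<lambda>x. (p x * p' x) / (q x * q' x))"
    by (rule rational_function_quotient)
       (use 1 2 in \<open>auto intro: poly_fun_intros admissible_denominator_mult\<close>)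
  moreover have "generically S (\<lambda>x. (p x * p' x) / (q x * q' x) = u x * v x)"
    using g1 g2 by (rule generically_conj2) auto
  ultimately show ?thesis by (rule rational_function_cong)
qed

text \<open>The dichotomy that replaces the field axiom: a rational function is generically zero or
  generically invertible.\<close>

lemma rational_function_zero_or_nonzero:
  assumes "irreducible_set S" "rational_function S u"
  shows "generically S (\<lambda>x. u x = 0) \<or> generically S (\<lambda>x. u x \<noteq> 0)"
proof -
  obtain p q where 1: "p \<in> poly_fun" "admissible_denominator S q"
    and g1: "generically S (\<lambda>x. u x = p x / q x)"
    using assms(2) unfolding rational_function_def by blast
  show ?thesis
  proof (cases "\<forall>x\<in>S. p x = 0")
    case True
    then have "generically S (\<lambda>x. u x = 0)" using generically_mono[OF g1] by simp
    then show ?thesis ..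
  next
    case False
    then have "generically S (\<lambda>x. p x \<noteq> 0)" using generically_nonzero assms(1) 1 by blast
    then have "generically S (\<lambda>x. u x \<noteq> 0)"
      by (rule generically_conj2[OF _ generically_conj[OF g1 admissible_denominator_generically[OF 1(2)]]])
         auto
    then show ?thesis ..
  qed
qed

lemma rational_function_divide:
  assumes "irreducible_set S" "rational_function S u" "rational_function S v"
  shows "rational_function S (\<lambda>x. u x / v x)"
proof -
  obtain p q where 1: "p \<in> poly_fun" "admissible_denominator S q"
    and g1: "generically S (\<lambda>x. v x = p x / q x)"
    using assms(3) unfolding rational_function_def by blast
  have "rational_function S (\<lambda>x. inverse (v x))"
  proof (cases "\<forall>x\<in>S. p x = 0")
    case True
    have "generically S (\<lambda>x. 0 = inverse (v x))"
      using g1 by (rule generically_mono) (use True in auto)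
    with rational_function_poly[OF poly_fun.const] show ?thesis by (rule rational_function_cong)
  next
    case False
    then have "rational_function S (\<lambda>x. q x / p x)"
      using 1 assms(1)
      by (intro rational_function_quotient) (auto simp: admissible_denominator_iff)
    then show ?thesis by (rule rational_function_cong) (use g1 in \<open>auto elim: generically_mono\<close>)
  qed
  from rational_function_mult[OF assms(2) this] show ?thesis by (simp add: divide_inverse)
qed

definition rational_coords :: "point set \<Rightarrow> (point \<Rightarrow> point) \<Rightarrow> bool" where
  "rational_coords S f \<longleftrightarrow> rational_function S (\<lambda>x. fst (f x)) \<and>
     rational_function S (\<lambda>x. fst (snd (f x))) \<and> rational_function S (\<lambda>x. snd (snd (f x)))"

lemma rational_map_iff:
  "rational_map S S' f \<longleftrightarrow> rational_coords S f \<and> generically S (\<lambda>x. f x \<in> S')"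
  by (auto simp: rational_map_def rational_coords_def)

lemma rational_function_poly_comp:
  assumes "p \<in> poly_fun" "rational_coords S f"
  shows "rational_function S (\<lambda>x. p (f x))"
  using assms(1)
proof induction
  case (const c) then show ?case by (intro rational_function_poly poly_fun.const)
next
  case coord1 then show ?case using assms(2) by (simp add: rational_coords_def case_prod_unfold)
next
  case coord2 then show ?case using assms(2) by (simp add: rational_coords_def case_prod_unfold)
next
  case coord3 then show ?case using assms(2) by (simp add: rational_coords_def case_prod_unfold)
qed (auto intro: rational_function_add rational_function_mult)


section \<open>Birational maps between irreducible sets\<close>

lemma dominantD:
  assumes "dominant S S' f" "p \<in> poly_fun" "generically S (\<lambda>x. p (f x) = 0)" "y \<in> S'"
  shows "p y = 0"
  using assms by (simp add: dominant_def)

text \<open>Generic statements may be pulled back along a dominant rational map: if the denominator \<open>q\<close> of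
  the statement vanished generically along \<open>f\<close>, dominance would make \<open>q\<close> vanish on all of \<open>S'\<close>.\<close>

lemma generically_comp:
  assumes "irreducible_set S" "irreducible_set S'" "rational_map S S' f" "dominant S S' f"
    and "generically S' P"
  shows "generically S (\<lambda>x. P (f x))"
proof -
  obtain q where q: "admissible_denominator S' q" "\<forall>x\<in>S'. q x \<noteq> 0 \<longrightarrow> P x"
    using assms(5) unfolding generically_def by blast
  have qp: "q \<in> poly_fun" "\<exists>y\<in>S'. q y \<noteq> 0"
    using q admissible_denominator_iff[OF assms(2)] by auto
  have "\<not> generically S (\<lambda>x. q (f x) = 0)"
    using dominantD[OF assms(4) qp(1)] qp(2) by blast
  then have "generically S (\<lambda>x. q (f x) \<noteq> 0)"
    using rational_function_zero_or_nonzero[OF assms(1)] rational_function_poly_comp[OF qp(1)]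
      assms(3) unfolding rational_map_iff by blast
  moreover have "generically S (\<lambda>x. f x \<in> S')" using assms(3) unfolding rational_map_iff by blast
  ultimately show ?thesis by (rule generically_conj2) (use q in auto)
qed

lemma rational_function_comp:
  assumes "irreducible_set S" "irreducible_set S'" "rational_map S S' f" "dominant S S' f"
    and "rational_function S' u"
  shows "rational_function S (\<lambda>x. u (f x))"
proof -
  obtain p q where 1: "p \<in> poly_fun" "admissible_denominator S' q"
    and g1: "generically S' (\<lambda>x. u x = p x / q x)"
    using assms(5) unfolding rational_function_def by blast
  have qp: "q \<in> poly_fun" using 1 by (simp add: admissible_denominator_def)
  have "rational_function S (\<lambda>x. p (f x) / q (f x))"
    using assms 1 qp
    by (intro rational_function_divide rational_function_poly_comp) (auto simp: rational_map_iff)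
  moreover have "generically S (\<lambda>x. p (f x) / q (f x) = u (f x))"
    using generically_comp[OF assms(1-4) g1] by (rule generically_mono) simp
  ultimately show ?thesis by (rule rational_function_cong)
qed

lemma rational_map_comp:
  assumes "irreducible_set S" "irreducible_set S'" "rational_map S S' f" "dominant S S' f"
    and "rational_map S' S'' g"
  shows "rational_map S S'' (g \<circ> f)"
  using assms rational_function_comp[OF assms(1-4)] generically_comp[OF assms(1-4)]
  unfolding rational_map_def by auto

lemma dominant_comp:
  assumes "irreducible_set S" "irreducible_set S'" "rational_map S S' f" "dominant S S' f"
    and "rational_map S' S'' g" "dominant S' S'' g"
  shows "dominant S S'' (g \<circ> f)"
  unfolding dominant_def
proof (intro ballI impI)
  fix p y assume p: "p \<in> poly_fun" "generically S (\<lambda>x. p ((g \<circ> f) x) = 0)" "y \<in> S''"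
  have "rational_function S' (\<lambda>x. p (g x))"
    using rational_function_poly_comp p assms(5) unfolding rational_map_iff by blast
  then have "generically S' (\<lambda>x. p (g x) = 0) \<or> generically S' (\<lambda>x. p (g x) \<noteq> 0)"
    using rational_function_zero_or_nonzero assms(2) by blast
  then show "p y = 0"
  proof
    assume "generically S' (\<lambda>x. p (g x) = 0)"
    then show ?thesis using dominantD[OF assms(6) p(1)] p(3) by blast
  next
    assume "generically S' (\<lambda>x. p (g x) \<noteq> 0)"
    from generically_comp[OF assms(1-4) this] have "generically S (\<lambda>x. p (g (f x)) \<noteq> 0)" .
    from generically_conj[OF this p(2)] have "generically S (\<lambda>x. False)" by simp
    then show ?thesis using generically_ex[OF assms(1)] by metis
  qed
qed

lemma birational_inverse_sym:
  "birational_inverse S S' f g \<Longrightarrow> birational_inverse S' S g f"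
  by (auto simp: birational_inverse_def)

lemma birational_inverse_comp:
  assumes "irreducible_set S" "irreducible_set S'" "irreducible_set S''"
    and f: "birational_inverse S S' f f'" and g: "birational_inverse S' S'' g g'"
  shows "birational_inverse S S'' (g \<circ> f) (f' \<circ> g')"
proof -
  have "generically S (\<lambda>x. f' (g' (g (f x))) = x)"
    if "irreducible_set S" "irreducible_set S'" "birational_inverse S S' f f'"
      "birational_inverse S' S'' g g'" for S S' S'' f f' g g'
  proof -
    have "generically S (\<lambda>x. g' (g (f x)) = f x)"
      using that generically_comp[of S S' f "\<lambda>x. g' (g x) = x"]
      unfolding birational_inverse_def by blast
    then show ?thesis
      by (rule generically_conj2[where Q = "\<lambda>x. f' (f x) = x"])
         (use that in \<open>auto simp: birational_inverse_def\<close>)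
  qed
  from this[of S S' f f' S'' g g'] this[of S'' S' g' g S f' f]
  show ?thesis
    using assms rational_map_comp[of S S' f S'' g] rational_map_comp[of S'' S' g' S f']
      dominant_comp[of S S' f S'' g] dominant_comp[of S'' S' g' S f'] birational_inverse_sym
    by (auto simp: birational_inverse_def)
qed

lemma birational_inverse_id:
  "birational_inverse S S id id"
  by (auto simp: birational_inverse_def rational_map_iff rational_coords_def dominant_def
      intro: generically_everywhere rational_function_poly poly_fun_intros generically_poly_zero)

lemma birational_comp:
  assumes "irreducible_set S" "birational S S f" "birational S S g"
  shows "birational S S (f \<circ> g)"
  using birational_inverse_comp assms unfolding birational_def by blast

lemma generically_comp_birational:
  assumes "irreducible_set S" "birational S S f" "generically S P"
  shows "generically S (\<lambda>x. P (f x))"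
  using assms generically_comp[of S S f P] unfolding birational_def birational_inverse_def by blast


section \<open>The group of birational self-maps\<close>

lemma map_class_eq_iff: "map_class S f = map_class S g \<longleftrightarrow> generically S (\<lambda>x. f x = g x)"
proof
  assume "map_class S f = map_class S g"
  moreover have "f \<in> map_class S f" by (auto simp: map_class_def intro: generically_everywhere)
  ultimately show "generically S (\<lambda>x. f x = g x)" by (simp add: map_class_def)
next
  assume g: "generically S (\<lambda>x. f x = g x)"
  show "map_class S f = map_class S g"
    unfolding map_class_def using generically_conj2[OF _ g] by (auto 0 4)
qed

lemma map_class_self: "f \<in> map_class S f"
  by (auto simp: map_class_def intro: generically_everywhere)

lemma map_class_in_Bir: "birational S S f \<Longrightarrow> map_class S f \<in> carrier (Bir S)"
  by (auto simp: Bir_def)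

lemma Bir_carrierE:
  assumes "F \<in> carrier (Bir S)"
  obtains f where "birational S S f" "F = map_class S f"
  using assms by (auto simp: Bir_def)

text \<open>The product in \<open>Bir\<close> is a union over all representatives; dominance of \<open>g\<close> makes the class of the
  composition independent of them.\<close>

lemma Bir_mult:
  assumes "irreducible_set S" "birational S S f" "birational S S g"
  shows "map_class S f \<otimes>\<^bsub>Bir S\<^esub> map_class S g = map_class S (f \<circ> g)"
proof -
  have "map_class S (f' \<circ> g') = map_class S (f \<circ> g)"
    if "f' \<in> map_class S f" "g' \<in> map_class S g" for f' g'
  proof -
    have 1: "generically S (\<lambda>x. f' (g x) = f (g x))"
      using generically_comp_birational[OF assms(1,3)] that(1) unfolding map_class_def by blast
    have 2: "generically S (\<lambda>x. g' x = g x)" using that(2) by (simp add: map_class_def)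
    show ?thesis unfolding map_class_eq_iff
      using 1 2 by (rule generically_conj2) simp
  qed
  then have "(\<Union>f'\<in>map_class S f. \<Union>g'\<in>map_class S g. map_class S (f' \<circ> g')) =
      (\<Union>f'\<in>map_class S f. \<Union>g'\<in>map_class S g. map_class S (f \<circ> g))"
    by (intro SUP_cong refl)
  also have "map_class S f \<noteq> {}" "map_class S g \<noteq> {}" using map_class_self by blast+
  then have "(\<Union>f'\<in>map_class S f. \<Union>g'\<in>map_class S g. map_class S (f \<circ> g)) =
      map_class S (f \<circ> g)" by simp
  finally show ?thesis by (simp add: Bir_def)
qed

lemma Bir_one: "\<one>\<^bsub>Bir S\<^esub> = map_class S id"
  by (simp add: Bir_def)

lemma birational_inverse_map_class:
  assumes "irreducible_set S" "birational_inverse S S f g"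
  shows "map_class S g \<otimes>\<^bsub>Bir S\<^esub> map_class S f = \<one>\<^bsub>Bir S\<^esub>"
proof -
  have "birational S S f" "birational S S g"
    using assms birational_inverse_sym unfolding birational_def by blast+
  then show ?thesis using assms
    by (simp add: Bir_mult Bir_one map_class_eq_iff birational_inverse_def)
qed

lemma group_Bir:
  assumes "irreducible_set S"
  shows "group (Bir S)"
proof (rule groupI)
  show "\<one>\<^bsub>Bir S\<^esub> \<in> carrier (Bir S)"
    using birational_inverse_id unfolding Bir_one birational_def[abs_def]
    by (intro map_class_in_Bir) (auto simp: birational_def)
next
  fix F G assume "F \<in> carrier (Bir S)" "G \<in> carrier (Bir S)"
  then show "F \<otimes>\<^bsub>Bir S\<^esub> G \<in> carrier (Bir S)"
    by (elim Bir_carrierE) (simp add: Bir_mult assms map_class_in_Bir birational_comp)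
next
  fix F G H assume "F \<in> carrier (Bir S)" "G \<in> carrier (Bir S)" "H \<in> carrier (Bir S)"
  then show "F \<otimes>\<^bsub>Bir S\<^esub> G \<otimes>\<^bsub>Bir S\<^esub> H = F \<otimes>\<^bsub>Bir S\<^esub> (G \<otimes>\<^bsub>Bir S\<^esub> H)"
    by (elim Bir_carrierE) (simp add: Bir_mult assms birational_comp comp_assoc)
next
  fix F assume "F \<in> carrier (Bir S)"
  moreover have "birational S S id" using birational_inverse_id birational_def by blast
  ultimately show "\<one>\<^bsub>Bir S\<^esub> \<otimes>\<^bsub>Bir S\<^esub> F = F"
    by (elim Bir_carrierE) (simp add: Bir_mult assms Bir_one)
next
  fix F assume "F \<in> carrier (Bir S)"
  then obtain f g where "birational_inverse S S f g" "F = map_class S f"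
    by (elim Bir_carrierE) (auto simp: birational_def)
  then show "\<exists>G\<in>carrier (Bir S). G \<otimes>\<^bsub>Bir S\<^esub> F = \<one>\<^bsub>Bir S\<^esub>"
    using birational_inverse_map_class[OF assms] birational_inverse_sym map_class_in_Bir
    unfolding birational_def by metis
qed

lemma Bir_inv:
  assumes "irreducible_set S" "birational_inverse S S f g"
  shows "inv\<^bsub>Bir S\<^esub> map_class S f = map_class S g"
proof -
  have "map_class S f \<in> carrier (Bir S)" "map_class S g \<in> carrier (Bir S)"
    using assms birational_inverse_sym map_class_in_Bir unfolding birational_def by blast+
  then show ?thesis
    using group.inv_equality[OF group_Bir[OF assms(1)] birational_inverse_map_class[OF assms]] by simp
qed

text \<open>The definite description in \<open>map_in_coords\<close> is resolved here.  Two birational maps with the same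
  pull-backs of \<open>u\<close> and \<open>v\<close> agree, because generic points are sent by both into the set where \<open>(u, v)\<close>
  is injective.\<close>

lemma map_in_coords_eq:
  assumes S: "irreducible_set S" and f: "birational S S f"
    and q: "q \<in> poly_fun" "x0 \<in> S" "q x0 \<noteq> 0"
    and inj: "\<And>x y. x \<in> S \<Longrightarrow> y \<in> S \<Longrightarrow> q x \<noteq> 0 \<Longrightarrow> q y \<noteq> 0 \<Longrightarrow> u x = u y \<Longrightarrow> v x = v y \<Longrightarrow> x = y"
    and AB: "generically S (\<lambda>x. (u (f x), v (f x)) = AB (u x) (v x))"
  shows "map_in_coords S u v AB = map_class S f"
  unfolding map_in_coords_def
proof (rule the_equality)
  have "generically S (\<lambda>x. (u (f' x), v (f' x)) = AB (u x) (v x))" if "f' \<in> map_class S f" for f'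
    using AB that unfolding map_class_def by (auto elim: generically_conj2)
  then show "map_class S f \<in> carrier (Bir S) \<and>
      (\<forall>f'\<in>map_class S f. generically S (\<lambda>x. (u (f' x), v (f' x)) = AB (u x) (v x)))"
    using f map_class_in_Bir by blast
next
  fix F assume F: "F \<in> carrier (Bir S) \<and>
      (\<forall>f\<in>F. generically S (\<lambda>x. (u (f x), v (f x)) = AB (u x) (v x)))"
  then obtain h where h: "birational S S h" "F = map_class S h" by (blast elim: Bir_carrierE)
  have h': "generically S (\<lambda>x. (u (h x), v (h x)) = AB (u x) (v x))"
    using F h map_class_self by blast
  have D: "generically S (\<lambda>x. f x \<in> S \<and> q (f x) \<noteq> 0)" if "birational S S f" for f
    using generically_comp_birational[OF S that generically_nonzero[OF S q]] that
    by (auto simp: birational_def birational_inverse_def rational_map_def intro: generically_conj)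
  have "generically S (\<lambda>x. (u (f x), v (f x)) = (u (h x), v (h x)))"
    using AB h' by (rule generically_conj2) simp
  then have "generically S (\<lambda>x. h x = f x)"
    by (rule generically_conj2[OF _ generically_conj[OF D[OF f] D[OF h(1)]]]) (auto intro: inj)
  then show "F = map_class S f" using h map_class_eq_iff by blast
qed


section \<open>Regular bijections of principal open subsets\<close>

text \<open>Functions on the principal open set \<open>q \<noteq> 0\<close> of \<open>S\<close> with a power of \<open>q\<close> as denominator.  Unlike
  generic equality this controls the values at every point of the open set, which is what a proof of
  dominance needs.\<close>

definition regular :: "point set \<Rightarrow> (point \<Rightarrow> complex) \<Rightarrow> (point \<Rightarrow> complex) \<Rightarrow> bool" where
  "regular S q u \<longleftrightarrow> (\<exists>p\<in>poly_fun. \<exists>n. \<forall>x\<in>S. q x \<noteq> 0 \<longrightarrow> u x = p x / q x ^ n)"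

lemma regularI:
  assumes "p \<in> poly_fun" "\<And>x. x \<in> S \<Longrightarrow> q x \<noteq> 0 \<Longrightarrow> u x = p x / q x ^ n"
  shows "regular S q u"
  unfolding regular_def using assms by (intro bexI[of _ p] exI[of _ n] ballI impI)

lemma regular_poly: "p \<in> poly_fun \<Longrightarrow> regular S q p"
  by (rule regularI[where n = 0]) auto

lemma regular_add:
  assumes "q \<in> poly_fun" "regular S q u" "regular S q v"
  shows "regular S q (\<lambda>x. u x + v x)"
proof -
  obtain p n p' n' where *: "p \<in> poly_fun" "\<forall>x\<in>S. q x \<noteq> 0 \<longrightarrow> u x = p x / q x ^ n"
    "p' \<in> poly_fun" "\<forall>x\<in>S. q x \<noteq> 0 \<longrightarrow> v x = p' x / q x ^ n'"
    using assms unfolding regular_def by blast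
  have "(\<lambda>x. p x * q x ^ n' + p' x * q x ^ n) \<in> poly_fun"
    using * assms by (intro poly_fun_intros)
  moreover have "\<forall>x\<in>S. q x \<noteq> 0 \<longrightarrow> u x + v x = (p x * q x ^ n' + p' x * q x ^ n) / q x ^ (n + n')"
    using * by (auto simp: field_simps power_add)
  ultimately show ?thesis by (intro regularI) auto
qed

lemma regular_mult:
  assumes "regular S q u" "regular S q v"
  shows "regular S q (\<lambda>x. u x * v x)"
proof -
  obtain p n p' n' where *: "p \<in> poly_fun" "\<forall>x\<in>S. q x \<noteq> 0 \<longrightarrow> u x = p x / q x ^ n"
    "p' \<in> poly_fun" "\<forall>x\<in>S. q x \<noteq> 0 \<longrightarrow> v x = p' x / q x ^ n'"
    using assms unfolding regular_def by blast
  then have "(\<lambda>x. p x * p' x) \<in> poly_fun"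
    "\<forall>x\<in>S. q x \<noteq> 0 \<longrightarrow> u x * v x = (p x * p' x) / q x ^ (n + n')"
    by (auto simp: power_add intro: poly_fun.mult)
  then show ?thesis by (intro regularI) auto
qed

lemma regular_const: "regular S q (\<lambda>_. c)"
  by (rule regular_poly) (rule poly_fun.const)

lemma regular_uminus: "regular S q u \<Longrightarrow> regular S q (\<lambda>x. - u x)"
  using regular_mult[OF regular_const[of S q "-1"], of u] by simp

lemma regular_diff:
  "q \<in> poly_fun \<Longrightarrow> regular S q u \<Longrightarrow> regular S q v \<Longrightarrow> regular S q (\<lambda>x. u x - v x)"
  using regular_add[of q S u "\<lambda>x. - v x"] regular_uminus[of S q v] by simp

lemma regular_power: "regular S q u \<Longrightarrow> regular S q (\<lambda>x. u x ^ n)"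
  by (induction n) (auto intro: regular_const regular_mult)

lemma regular_inverse_factor:
  assumes "r \<in> poly_fun" "\<And>x. x \<in> S \<Longrightarrow> q x \<noteq> 0 \<Longrightarrow> v x * r x = q x"
  shows "regular S q (\<lambda>x. inverse (v x))"
proof (rule regularI[where n = 1])
  fix x assume "x \<in> S" "q x \<noteq> 0"
  then have "v x * r x = q x" "v x \<noteq> 0" using assms(2)[of x] by auto
  then show "inverse (v x) = r x / q x ^ 1" using \<open>q x \<noteq> 0\<close> by (auto simp: field_simps)
qed (rule assms(1))

lemma regular_cong:
  assumes "regular S q u" "\<And>x. x \<in> S \<Longrightarrow> q x \<noteq> 0 \<Longrightarrow> v x = u x"
  shows "regular S q v"
proof -
  obtain p n where "p \<in> poly_fun" "\<forall>x\<in>S. q x \<noteq> 0 \<longrightarrow> u x = p x / q x ^ n"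
    using assms(1) unfolding regular_def by blast
  then show ?thesis using assms(2) by (intro regularI[of p]) auto
qed

lemma regular_divide:
  "regular S q u \<Longrightarrow> regular S q (\<lambda>x. inverse (v x)) \<Longrightarrow> regular S q (\<lambda>x. u x / v x)"
  unfolding divide_inverse by (rule regular_mult)

lemma regular_power_int:
  assumes "regular S q u" "regular S q (\<lambda>x. inverse (u x))"
  shows "regular S q (\<lambda>x. u x powi n)"
  using regular_power[OF assms(1), of "nat n"] regular_power[OF assms(2), of "nat (- n)"]
  by (cases "n \<ge> 0") (simp_all add: power_int_def)

definition regular_map :: "point set \<Rightarrow> (point \<Rightarrow> complex) \<Rightarrow> (point \<Rightarrow> point) \<Rightarrow> bool" where
  "regular_map S q f \<longleftrightarrow> regular S q (\<lambda>x. fst (f x)) \<and>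
     regular S q (\<lambda>x. fst (snd (f x))) \<and> regular S q (\<lambda>x. snd (snd (f x)))"

lemma regular_poly_comp:
  assumes "p \<in> poly_fun" "q \<in> poly_fun" "regular_map S q f"
  shows "regular S q (\<lambda>x. p (f x))"
  using assms(1)
proof induction
  case (const c) then show ?case by (rule regular_const)
next
  case coord1 then show ?case using assms(3) by (simp add: regular_map_def case_prod_unfold)
next
  case coord2 then show ?case using assms(3) by (simp add: regular_map_def case_prod_unfold)
next
  case coord3 then show ?case using assms(3) by (simp add: regular_map_def case_prod_unfold)
qed (auto intro: regular_add regular_mult assms(2))

lemma regular_rational_function:
  assumes "irreducible_set S" "q \<in> poly_fun" "x0 \<in> S" "q x0 \<noteq> 0" "regular S q u"
  shows "rational_function S u"
proof -
  obtain p n where p: "p \<in> poly_fun" "\<forall>x\<in>S. q x \<noteq> 0 \<longrightarrow> u x = p x / q x ^ n"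
    using assms(5) unfolding regular_def by blast
  have "q x0 ^ n \<noteq> 0" using assms(4) by simp
  then have "admissible_denominator S (\<lambda>x. q x ^ n)"
    unfolding admissible_denominator_iff[OF assms(1)]
    using assms(3) poly_fun_power[OF assms(2), of n] by (intro conjI bexI[of _ x0])
  from rational_function_quotient[OF p(1) this] show ?thesis
    by (rule rational_function_cong) (rule genericallyI[OF assms(1-4)], use p in simp)
qed

text \<open>All birational maps of this theory arise from this criterion.  For dominance, suppose \<open>p \<circ> f\<close> vanishes
  where \<open>r \<noteq> 0\<close>.  Then \<open>p\<close> vanishes at those \<open>y\<close> with \<open>r (g y) \<noteq> 0\<close>; as \<open>r \<circ> g\<close> is regular, its
  numerator \<open>N\<close> exhibits this set as a principal open set, which is nonempty since \<open>f\<close> maps into it some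
  point with \<open>r \<noteq> 0\<close>.\<close>

lemma birational_inverse_regular:
  assumes S: "irreducible_set S" "irreducible_set S'"
    and q: "q \<in> poly_fun" "q' \<in> poly_fun" "x0 \<in> S" "q x0 \<noteq> 0"
    and fg: "\<And>x. x \<in> S \<Longrightarrow> q x \<noteq> 0 \<Longrightarrow> f x \<in> S' \<and> q' (f x) \<noteq> 0 \<and> g (f x) = x"
    and gf: "\<And>y. y \<in> S' \<Longrightarrow> q' y \<noteq> 0 \<Longrightarrow> g y \<in> S \<and> q (g y) \<noteq> 0 \<and> f (g y) = y"
    and reg: "regular_map S q f" "regular_map S' q' g"
  shows "birational_inverse S S' f g"
proof -
  have *: "rational_map S S' f \<and> dominant S S' f \<and> generically S (\<lambda>x. g (f x) = x)"
    if S: "irreducible_set S" "irreducible_set S'"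
    and q: "q \<in> poly_fun" "q' \<in> poly_fun" "x0 \<in> S" "q x0 \<noteq> 0"
    and fg: "\<And>x. x \<in> S \<Longrightarrow> q x \<noteq> 0 \<Longrightarrow> f x \<in> S' \<and> q' (f x) \<noteq> 0 \<and> g (f x) = x"
    and gf: "\<And>y. y \<in> S' \<Longrightarrow> q' y \<noteq> 0 \<Longrightarrow> g y \<in> S \<and> q (g y) \<noteq> 0 \<and> f (g y) = y"
    and reg: "regular_map S q f" "regular_map S' q' g"
    for S S' q q' x0 f g
  proof (intro conjI)
    show "rational_map S S' f"
      unfolding rational_map_iff rational_coords_def
      using reg(1) unfolding regular_map_def
      by (intro conjI regular_rational_function[OF S(1) q(1,3,4)] genericallyI[OF S(1) q(1,3,4)])
         (simp_all add: fg)
    show "generically S (\<lambda>x. g (f x) = x)"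
      by (rule genericallyI[OF S(1) q(1,3,4)]) (simp add: fg)
    show "dominant S S' f"
      unfolding dominant_def
    proof (intro ballI impI)
      fix p y assume p: "p \<in> poly_fun" "generically S (\<lambda>x. p (f x) = 0)" and y: "y \<in> S'"
      then obtain r where r: "admissible_denominator S r" "\<forall>x\<in>S. r x \<noteq> 0 \<longrightarrow> p (f x) = 0"
        unfolding generically_def by blast
      obtain N n where N: "N \<in> poly_fun" "\<forall>y\<in>S'. q' y \<noteq> 0 \<longrightarrow> r (g y) = N y / q' y ^ n"
        using regular_poly_comp[OF admissible_denominatorD(1)[OF r(1)] q(2) reg(2)]
        unfolding regular_def by blast
      have "generically S (\<lambda>x. r x \<noteq> 0 \<and> q x \<noteq> 0)"
        using generically_conj[OF admissible_denominator_generically[OF r(1)]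
            generically_nonzero[OF S(1) q(1,3,4)]] .
      then obtain x1 where x1: "x1 \<in> S" "r x1 \<noteq> 0" "q x1 \<noteq> 0" 
        by (rule generically_ex[OF S(1)]) auto
      then have f1: "f x1 \<in> S'" "q' (f x1) \<noteq> 0" "N (f x1) \<noteq> 0" using fg[of x1] N by auto
      have "generically S' (\<lambda>y. p y = 0)"
      proof (rule genericallyI[OF S(2) poly_fun.mult[OF N(1) q(2)] f1(1)])
        show "N (f x1) * q' (f x1) \<noteq> 0" using f1 by simp
        show "p y = 0" if "y \<in> S'" "N y * q' y \<noteq> 0" for y
        proof -
          have y: "g y \<in> S" "f (g y) = y" using that gf[of y] by simp_all
          have "r (g y) \<noteq> 0" using that N(2) by simp
          then have "p (f (g y)) = 0" using y(1) r(2) by blast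
          then show ?thesis using y(2) by simp
        qed
      qed
      from generically_poly_zero[OF p(1) this y] show "p y = 0" .
    qed
  qed
  have y0: "f x0 \<in> S'" "q' (f x0) \<noteq> 0" using fg q by auto
  show ?thesis
    using *[OF S q fg gf reg] *[OF S(2,1) q(2,1) y0 gf fg reg(2,1)]
    by (simp add: birational_inverse_def)
qed

section \<open>Cubic surfaces that are monic quadratic in the first coordinate\<close>

text \<open>A root of a monic quadratic can be continued when the coefficients move: the product of the
  distances from \<open>x\<close> to the two roots is the absolute value at \<open>x\<close> of the perturbed polynomial, so the
  nearer root is at most the square root of that value away.\<close>

lemma quadratic_root_tendsto:
  fixes x b c :: complex
  assumes x: "x^2 + b * x + c = 0" and B: "(B \<longlongrightarrow> b) F" and C: "(C \<longlongrightarrow> c) F"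
  obtains X where "\<And>t. (X t)^2 + B t * X t + C t = 0" "(X \<longlongrightarrow> x) F"
proof -
  define r where "r t = (- B t + csqrt ((B t)^2 - 4 * C t)) / 2" for t
  define r' where "r' t = (- B t - csqrt ((B t)^2 - 4 * C t)) / 2" for t
  define X where "X t = (if norm (x - r t) \<le> norm (x - r' t) then r t else r' t)" for t
  have factor: "(y - r t) * (y - r' t) = y^2 + B t * y + C t" for y t
  proof -
    have "(y - r t) * (y - r' t) = ((2 * y + B t)^2 - (csqrt ((B t)^2 - 4 * C t))^2) / 4"
      by (simp add: r_def r'_def field_simps power2_eq_square del: power2_csqrt)
    also have "\<dots> = y^2 + B t * y + C t" unfolding power2_csqrt by (simp add: field_simps power2_eq_square)
    finally show ?thesis .
  qed
  have root: "(X t)^2 + B t * X t + C t = 0" for t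
    unfolding factor[symmetric] X_def by simp
  have "((\<lambda>t. x^2 + B t * x + C t) \<longlongrightarrow> x^2 + b * x + c) F" by (intro tendsto_intros B C)
  then have "((\<lambda>t. sqrt (norm (x^2 + B t * x + C t))) \<longlongrightarrow> sqrt (norm (0::complex))) F"
    unfolding x by (intro tendsto_intros)
  then have lim: "((\<lambda>t. sqrt (norm (x^2 + B t * x + C t))) \<longlongrightarrow> 0) F" by simp
  have "norm (X t - x) \<le> sqrt (norm (x^2 + B t * x + C t))" for t
  proof (rule real_le_rsqrt)
    have "norm (X t - x) ^ 2 \<le> norm (x - r t) * norm (x - r' t)"
      unfolding X_def power2_eq_square by (auto simp: norm_minus_commute intro!: mult_mono)
    then show "norm (X t - x) ^ 2 \<le> norm (x^2 + B t * x + C t)"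
      by (simp add: factor[symmetric] norm_mult)
  qed
  then have "((\<lambda>t. X t - x) \<longlongrightarrow> 0) F"
    by (intro tendsto_0_le[OF lim, of _ 1] always_eventually) simp
  then have "(X \<longlongrightarrow> x) F" by (simp add: LIM_zero_iff)
  with root show ?thesis by (rule that)
qed

lemma poly_fun_tendsto:
  assumes "p \<in> poly_fun" "(A \<longlongrightarrow> a) F" "(B \<longlongrightarrow> b) F" "(C \<longlongrightarrow> c) F"
  shows "((\<lambda>t. p (A t, B t, C t)) \<longlongrightarrow> p (a, b, c)) F"
  using assms(1) by induction (auto intro!: tendsto_intros assms)

lemma poly_fun_closed_condition:
  assumes "p \<in> poly_fun" "(A \<longlongrightarrow> a) F" "(B \<longlongrightarrow> b) F" "(C \<longlongrightarrow> c) F" "F \<noteq> bot"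
    and "eventually (\<lambda>t. p (A t, B t, C t) = 0) F"
  shows "p (a, b, c) = 0"
proof -
  have "((\<lambda>_. 0) \<longlongrightarrow> p (a, b, c)) F"
    using poly_fun_tendsto[OF assms(1-4)] assms(6) by (rule Lim_transform_eventually)
  then show ?thesis using assms(5) by (simp add: tendsto_const_iff)
qed

lemma poly_nonzero_eventually_at:
  fixes P :: "complex poly"
  assumes "P \<noteq> 0"
  shows "eventually (\<lambda>t. poly P t \<noteq> 0) (at b)"
proof -
  have "open (- ({t. poly P t = 0} - {b}))"
    using poly_roots_finite[OF assms] by (intro open_Compl finite_imp_closed) auto
  then show ?thesis unfolding eventually_at_topological by (intro exI[of _ "- ({t. poly P t = 0} - {b})"]) auto
qed

text \<open>A polynomial function becomes a rational function of the parameter along a curve whose third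
  coordinate has denominator \<open>D\<close>.\<close>

lemma poly_fun_on_rational_curve:
  fixes A B C D :: "complex poly"
  assumes "p \<in> poly_fun"
  shows "\<exists>R n. \<forall>t. poly D t \<noteq> 0 \<longrightarrow>
    p (poly A t, poly B t, poly C t / poly D t) = poly R t / poly D t ^ n"
  using assms
proof induction
  case (const c) show ?case by (rule exI[of _ "[:c:]"], rule exI[of _ 0]) simp
next
  case coord1 show ?case by (rule exI[of _ A], rule exI[of _ 0]) simp
next
  case coord2 show ?case by (rule exI[of _ B], rule exI[of _ 0]) simp
next
  case coord3 show ?case by (rule exI[of _ C], rule exI[of _ 1]) simp
next
  case (add p q)
  then obtain R n R' n' where
    "\<forall>t. poly D t \<noteq> 0 \<longrightarrow> p (poly A t, poly B t, poly C t / poly D t) = poly R t / poly D t ^ n"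
    "\<forall>t. poly D t \<noteq> 0 \<longrightarrow> q (poly A t, poly B t, poly C t / poly D t) = poly R' t / poly D t ^ n'"
    by blast
  then show ?case
    by (intro exI[of _ "R * D ^ n' + R' * D ^ n"] exI[of _ "n + n'"])
       (auto simp: field_simps power_add)
next
  case (mult p q)
  then obtain R n R' n' where
    "\<forall>t. poly D t \<noteq> 0 \<longrightarrow> p (poly A t, poly B t, poly C t / poly D t) = poly R t / poly D t ^ n"
    "\<forall>t. poly D t \<noteq> 0 \<longrightarrow> q (poly A t, poly B t, poly C t / poly D t) = poly R' t / poly D t ^ n'"
    by blast
  then show ?case
    by (intro exI[of _ "R * R'"] exI[of _ "n + n'"]) (auto simp: power_add)
qed


section \<open>The surface and its plane chart\<close>

definition chart :: "complex \<Rightarrow> complex \<Rightarrow> complex \<Rightarrow> complex \<Rightarrow> complex \<Rightarrow> point" where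
  "chart e0 e3 e4 a b = (a, b, - (a^2 + b^2 - theta1 e0 e3 e4 * a - theta2 e0 e3 e4 * b
     + theta4 e0 e3 e4) / (a * b - e0))"

lemma fst_chart [simp]: "fst (chart e0 e3 e4 a b) = a"
  and fst_snd_chart [simp]: "fst (snd (chart e0 e3 e4 a b)) = b"
  by (simp_all add: chart_def)

lemma z1_eq: "z1 e0 x = fst x * fst (snd x) - e0"
  by (simp add: z1_def case_prod_unfold)

lemma y1_eq: "y1 x = fst x"
  by (simp add: y1_def case_prod_unfold)

lemma y2_eq: "y2 x = fst (snd x)"
  by (simp add: y2_def case_prod_unfold)

lemma z1_poly: "z1 e0 \<in> poly_fun"
  unfolding z1_eq[abs_def] by (intro poly_fun_intros)

lemma mem_CVI: "(x1, x2, x3) \<in> CVI e0 e3 e4 k \<longleftrightarrow> x1 * x2 * x3 + x1^2 + x2^2 + x3^2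
     - Theta1 e0 e3 e4 k * x1 - Theta2 e0 e3 e4 k * x2 - Theta3 e0 e3 e4 k * x3
     + Theta4 e0 e3 e4 k = 0"
  by (simp add: CVI_def)

lemma Theta_expand:
  "Theta1 e0 e3 e4 k = (k + inverse k) * par e4 + (e0 * inverse k + inverse e0 * k) * par e3"
  "Theta2 e0 e3 e4 k = (e0 * inverse k + inverse e0 * k) * par e4 + par e3 * (k + inverse k)"
  "Theta3 e0 e3 e4 k = par e3 * par e4 + (k + inverse k) * (e0 * inverse k + inverse e0 * k)"
  "Theta4 e0 e3 e4 k = (k + inverse k) * (e0 * inverse k + inverse e0 * k) * par e3 * par e4
     + ((k + inverse k)^2 + (e0 * inverse k + inverse e0 * k)^2 + (par e3)^2 + (par e4)^2) - 4"
  by (simp_all add: Theta1_def Theta2_def Theta3_def Theta4_def b1_def b2_def)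

lemma theta_expand:
  "theta1 e0 e3 e4 = par e3 + e0 * par e4" "theta2 e0 e3 e4 = par e4 + e0 * par e3"
  "theta4 e0 e3 e4 = e0^2 + e0 * par e3 * par e4 + 1"
  by (simp_all add: theta1_def theta2_def theta4_def)

locale cubic_surface =
  fixes e0 e3 e4 :: complex
  assumes e0: "e0 \<noteq> 0"
begin

abbreviation "S \<equiv> CV e0 e3 e4"
abbreviation "ch \<equiv> chart e0 e3 e4"
abbreviation "T1 \<equiv> theta1 e0 e3 e4"
abbreviation "T2 \<equiv> theta2 e0 e3 e4"
abbreviation "T4 \<equiv> theta4 e0 e3 e4"
abbreviation "z \<equiv> z1 e0"

lemma mem_CV: "(a, b, c) \<in> S \<longleftrightarrow> (a * b - e0) * c + (a^2 + b^2 - T1 * a - T2 * b + T4) = 0"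
  by (simp add: CV_def theta3_def algebra_simps)

lemma chart_in_CV: "a * b \<noteq> e0 \<Longrightarrow> ch a b \<in> S"
  by (simp add: chart_def mem_CV)

lemma CV_eq_chart:
  assumes "x \<in> S" "z x \<noteq> 0"
  shows "x = ch (fst x) (fst (snd x))"
proof -
  obtain a b c where x: "x = (a, b, c)" by (cases x)
  have "(a * b - e0) * c = - (a^2 + b^2 - T1 * a - T2 * b + T4)"
    using assms(1) unfolding x mem_CV by (simp add: add_eq_0_iff2)
  then show ?thesis using assms(2) by (simp add: x z1_eq chart_def eq_divide_eq mult.commute)
qed

text \<open>The polynomial in \<open>x\<^sub>2\<close> equal to \<open>z\<^sub>1 z\<^sub>2\<close> on the surface.\<close>

definition P2 :: "complex poly" where
  "P2 = [:e0^2, - (e0 * T1), T4, - T2, 1:]"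

lemma poly_P2: "poly P2 b = b^4 - T2 * b^3 + T4 * b^2 - e0 * T1 * b + e0^2"
  by (simp add: P2_def algebra_simps power2_eq_square power3_eq_cube power4_eq_xxxx)

text \<open>The chart misses only the points with \<open>z = 0\<close>, where \<open>x\<^sub>2\<close> is a root of \<open>P2\<close>.  Keeping \<open>x\<^sub>3\<close> and moving
  \<open>x\<^sub>2\<close> away from the finitely many roots, with \<open>x\<^sub>1\<close> following continuously, one approaches such a point
  from within the chart.\<close>

lemma poly_fun_dense_chart:
  assumes p: "p \<in> poly_fun" and zero: "\<And>x. x \<in> S \<Longrightarrow> z x \<noteq> 0 \<Longrightarrow> p x = 0" and "x \<in> S"
  shows "p x = 0"
proof -
  obtain a b c where x: "x = (a, b, c)" by (cases x)
  have "a^2 + (b * c - T1) * a + (b^2 - T2 * b - e0 * c + T4) = 0"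
    using \<open>x \<in> S\<close> unfolding x mem_CV by (simp add: algebra_simps)
  moreover have "((\<lambda>t. t * c - T1) \<longlongrightarrow> b * c - T1) (at b)"
    "((\<lambda>t. t^2 - T2 * t - e0 * c + T4) \<longlongrightarrow> b^2 - T2 * b - e0 * c + T4) (at b)"
    by (intro tendsto_intros)+
  ultimately obtain X where
    X: "\<And>t. (X t)^2 + (t * c - T1) * X t + (t^2 - T2 * t - e0 * c + T4) = 0" and
    lim: "(X \<longlongrightarrow> a) (at b)"
    by (rule quadratic_root_tendsto) blast
  have S: "(X t, t, c) \<in> S" for t
    using X[of t] unfolding mem_CV by (simp add: algebra_simps)
  have "P2 \<noteq> 0" by (simp add: P2_def)
  then have "eventually (\<lambda>t. p (X t, t, c) = 0) (at b)"
  proof (rule eventually_mono[OF poly_nonzero_eventually_at])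
    fix t assume t: "poly P2 t \<noteq> 0"
    have "z (X t, t, c) \<noteq> 0"
    proof
      assume "z (X t, t, c) = 0"
      then have e: "X t * t = e0" by (simp add: z1_eq)
      then have "(X t)^2 + t^2 - T1 * X t - T2 * t + T4 = 0" using S[of t] by (simp add: mem_CV)
      then have "0 = t^2 * ((X t)^2 + t^2 - T1 * X t - T2 * t + T4)" by simp
      also have "\<dots> = (X t * t)^2 + t^4 - T1 * t * (X t * t) - T2 * t^3 + T4 * t^2" by algebra
      also have "\<dots> = poly P2 t" by (simp add: e poly_P2)
      finally show False using t by simp
    qed
    then show "p (X t, t, c) = 0" using zero S by simp
  qed
  from poly_fun_closed_condition[OF p lim tendsto_ident_at tendsto_const _ this]
  show ?thesis by (simp add: x)
qed

text \<open>If \<open>p q\<close> vanished on the surface but neither factor did, there would be points \<open>x\<close> and \<open>y\<close> of the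
  chart with \<open>p x \<noteq> 0\<close> and \<open>q y \<noteq> 0\<close>.  On the lift of the line through their images in the plane, \<open>p\<close>
  and \<open>q\<close> would be nonzero rational functions of one variable with product zero.\<close>

lemma irreducible_CV: "irreducible_set S"
  unfolding irreducible_set_def
proof (intro conjI ballI impI)
  have "ch 0 0 \<in> S" using e0 by (intro chart_in_CV) auto
  then show "S \<noteq> {}" by blast
next
  fix p q assume p: "p \<in> poly_fun" and q: "q \<in> poly_fun" and pq: "\<forall>x\<in>S. p x * q x = 0"
  show "(\<forall>x\<in>S. p x = 0) \<or> (\<forall>x\<in>S. q x = 0)"
  proof (rule ccontr)
    assume "\<not> ?thesis"
    then obtain x y where x: "x \<in> S" "z x \<noteq> 0" "p x \<noteq> 0" and y: "y \<in> S" "z y \<noteq> 0" "q y \<noteq> 0"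
      using poly_fun_dense_chart[OF p] poly_fun_dense_chart[OF q] by metis
    define A where "A = [:fst x, fst y - fst x:]"
    define B where "B = [:fst (snd x), fst (snd y) - fst (snd x):]"
    define D where "D = A * B - [:e0:]"
    define C where "C = - (A^2 + B^2 - smult T1 A - smult T2 B + [:T4:])"
    have curve: "(poly A t, poly B t, poly C t / poly D t) = ch (poly A t) (poly B t)" for t
      by (simp add: C_def D_def chart_def)
    have inS: "ch (poly A t) (poly B t) \<in> S" if "poly D t \<noteq> 0" for t
      using that by (intro chart_in_CV) (auto simp: D_def)
    obtain R n R' n' where
      R: "\<forall>t. poly D t \<noteq> 0 \<longrightarrow> p (ch (poly A t) (poly B t)) = poly R t / poly D t ^ n" and
      R': "\<forall>t. poly D t \<noteq> 0 \<longrightarrow> q (ch (poly A t) (poly B t)) = poly R' t / poly D t ^ n'"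
      using poly_fun_on_rational_curve[OF p, of D A B C] poly_fun_on_rational_curve[OF q, of D A B C]
      unfolding curve by blast
    have "poly (R * R' * D) t = 0" for t
    proof (cases "poly D t = 0")
      case False
      then have "p (ch (poly A t) (poly B t)) * q (ch (poly A t) (poly B t)) = 0"
        using pq inS by blast
      then show ?thesis using R R' False by auto
    qed simp
    then have "R * R' * D = 0" using poly_all_0_iff_0 by blast
    moreover have D: "poly D 0 = z x" "poly D 1 = z y"
      by (simp_all add: D_def A_def B_def z1_eq algebra_simps)
    moreover have "poly R 0 \<noteq> 0"
    proof -
      have "ch (poly A 0) (poly B 0) = x" using CV_eq_chart[OF x(1,2)] by (simp add: A_def B_def)
      then show ?thesis using R[rule_format, of 0] x D by auto
    qed
    moreover have "poly R' 1 \<noteq> 0"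
    proof -
      have "ch (poly A 1) (poly B 1) = y" using CV_eq_chart[OF y(1,2)] by (simp add: A_def B_def)
      then show ?thesis using R'[rule_format, of 1] y D by auto
    qed
    ultimately show False using x by auto
  qed
qed

lemma group_Bir_CV: "group (Bir S)"
  by (rule group_Bir) (rule irreducible_CV)

lemma generically_z1: "generically S (\<lambda>x. z x \<noteq> 0)"
  using e0 by (intro generically_nonzero[OF irreducible_CV z1_poly chart_in_CV[of 0 0]])
    (auto simp: z1_eq)

lemma generically_y1: "generically S (\<lambda>x. fst x \<noteq> 0)"
  using e0 by (intro generically_nonzero[OF irreducible_CV poly_fun_fst chart_in_CV[of 1 0]]) auto

lemma generically_y2: "generically S (\<lambda>x. fst (snd x) \<noteq> 0)"
  using e0 by (intro generically_nonzero[OF irreducible_CV poly_fun_fst_snd chart_in_CV[of 0 1]]) auto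

section \<open>Birational maps given in the chart\<close>

lemma regular_chart:
  assumes q: "q \<in> poly_fun" and "regular S q A" "regular S q B"
    and "regular S q (\<lambda>x. inverse (A x * B x - e0))"
  shows "regular_map S q (\<lambda>x. ch (A x) (B x))"
proof -
  have "regular S q (\<lambda>x. - ((A x)^2 + (B x)^2 - T1 * A x - T2 * B x + T4) / (A x * B x - e0))"
    using assms
    by (intro regular_divide regular_uminus regular_add regular_diff regular_mult regular_power
        regular_const)
  then show ?thesis using assms(2,3) by (simp add: regular_map_def chart_def)
qed

text \<open>The open set \<open>q \<noteq> 0\<close> is taken inside the chart and stable under both maps, so that only the first two
  coordinates need to be compared.\<close>

lemma birational_inverse_chart:
  assumes q: "q \<in> poly_fun" "x0 \<in> S" "q x0 \<noteq> 0" and qz: "\<And>x. q x \<noteq> 0 \<Longrightarrow> z x \<noteq> 0"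
    and f: "\<And>x. x \<in> S \<Longrightarrow> q x \<noteq> 0 \<Longrightarrow> q (ch (A x) (B x)) \<noteq> 0 \<and>
       A' (ch (A x) (B x)) = fst x \<and> B' (ch (A x) (B x)) = fst (snd x)"
    and g: "\<And>x. x \<in> S \<Longrightarrow> q x \<noteq> 0 \<Longrightarrow> q (ch (A' x) (B' x)) \<noteq> 0 \<and>
       A (ch (A' x) (B' x)) = fst x \<and> B (ch (A' x) (B' x)) = fst (snd x)"
    and "regular S q A" "regular S q B" "regular S q (\<lambda>x. inverse (A x * B x - e0))"
    and "regular S q A'" "regular S q B'" "regular S q (\<lambda>x. inverse (A' x * B' x - e0))"
  shows "birational_inverse S S (\<lambda>x. ch (A x) (B x)) (\<lambda>x. ch (A' x) (B' x))"
proof -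
  have *: "ch (A x) (B x) \<in> S \<and> q (ch (A x) (B x)) \<noteq> 0 \<and>
      ch (A' (ch (A x) (B x))) (B' (ch (A x) (B x))) = x"
    if x: "x \<in> S" "q x \<noteq> 0" and f: "q (ch (A x) (B x)) \<noteq> 0 \<and>
       A' (ch (A x) (B x)) = fst x \<and> B' (ch (A x) (B x)) = fst (snd x)" for A B A' B' x
  proof -
    have "z (ch (A x) (B x)) \<noteq> 0" using qz f by blast
    then have "ch (A x) (B x) \<in> S" by (intro chart_in_CV) (auto simp: z1_eq)
    then show ?thesis using f CV_eq_chart[OF x(1) qz[OF x(2)]] by simp
  qed
  show ?thesis
    by (rule birational_inverse_regular[OF irreducible_CV irreducible_CV q(1,1,2,3)])
       (use f g * in \<open>blast intro: regular_chart assms\<close>)+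
qed

abbreviation G :: "(point \<Rightarrow> point) set monoid" where "G \<equiv> Bir S"

abbreviation cls :: "(point \<Rightarrow> point) \<Rightarrow> (point \<Rightarrow> point) set" where "cls \<equiv> map_class S"

lemma cls_mult:
  "birational S S f \<Longrightarrow> birational S S g \<Longrightarrow> cls f \<otimes>\<^bsub>G\<^esub> cls g = cls (f \<circ> g)"
  by (rule Bir_mult[OF irreducible_CV])

lemma cls_eqI: "generically S (\<lambda>x. f x = g x) \<Longrightarrow> cls f = cls g"
  by (simp add: map_class_eq_iff)

definition scale_y1 :: "complex \<Rightarrow> point \<Rightarrow> point" where
  "scale_y1 l = (\<lambda>x. ch (fst x) ((l * z x + e0) / fst x))"

text \<open>The integer \<open>n\<close> covers at once the torus fixing \<open>x\<^sub>2\<close> (\<open>n = 0\<close>), the generator \<open>m_half\<close> (\<open>n = -2\<close>) and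
  the extra generator of the extended confluent group (\<open>n = 2\<close>).\<close>

definition scale_y2 :: "complex \<Rightarrow> int \<Rightarrow> point \<Rightarrow> point" where
  "scale_y2 l n = (\<lambda>x. ch ((l * fst (snd x) powi n * z x + e0) / fst (snd x)) (fst (snd x)))"

definition stokes :: "point \<Rightarrow> point" where
  "stokes = (\<lambda>x. ch ((fst x)^2 * fst (snd x) / e0) (e0 / fst x))"

definition stokes_inv :: "point \<Rightarrow> point" where
  "stokes_inv = (\<lambda>x. ch (e0 / fst (snd x)) (fst x * (fst (snd x))^2 / e0))"

lemma z_scale_y1: "fst x \<noteq> 0 \<Longrightarrow> z (scale_y1 l x) = l * z x"
  by (simp add: scale_y1_def z1_eq)

lemma z_scale_y2: "fst (snd x) \<noteq> 0 \<Longrightarrow> z (scale_y2 l n x) = l * fst (snd x) powi n * z x"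
  by (simp add: scale_y2_def z1_eq)

lemma z_stokes: "fst x \<noteq> 0 \<Longrightarrow> z (stokes x) = z x"
  using e0 by (simp add: stokes_def z1_eq power2_eq_square)

lemma z_stokes_inv: "fst (snd x) \<noteq> 0 \<Longrightarrow> z (stokes_inv x) = z x"
  using e0 by (simp add: stokes_inv_def z1_eq power2_eq_square)

lemmas regular_intros = regular_divide regular_add regular_diff regular_mult
  regular_power regular_const regular_poly poly_fun_intros z1_poly

lemma ex_point: "\<exists>x\<in>S. fst x * fst (snd x) * z x \<noteq> 0"
  using generically_ex[OF irreducible_CV
      generically_conj[OF generically_z1 generically_conj[OF generically_y1 generically_y2]]]
  by (metis mult_eq_0_iff)

lemma birational_inverse_scale_y1:
  assumes l: "l \<noteq> 0"
  shows "birational_inverse S S (scale_y1 l) (scale_y1 (1 / l))"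
proof -
  let ?q = "\<lambda>x. fst x * z x"
  let ?B = "\<lambda>l x. (l * z x + e0) / fst x"
  obtain x0 where x0: "x0 \<in> S" "?q x0 \<noteq> 0" using ex_point by auto
  have q: "?q \<in> poly_fun" by (intro poly_fun_intros z1_poly)
  have inv: "?q (ch (fst x) (?B l x)) \<noteq> 0 \<and> fst (ch (fst x) (?B l x)) = fst x \<and>
      ?B m (ch (fst x) (?B l x)) = fst (snd x)"
    if "?q x \<noteq> 0" "l * m = 1" for x l m
  proof -
    have "z (ch (fst x) (?B l x)) = l * z x" using that by (simp add: z1_eq)
    then show ?thesis using that by (auto simp: z1_eq mult.assoc[symmetric] mult.commute[of m])
  qed
  have reg1: "regular S ?q (?B l)" for l
    by (intro regular_intros regular_inverse_factor[OF z1_poly]) auto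
  have reg2: "regular S ?q (\<lambda>x. inverse (fst x * ?B l x - e0))" if "l \<noteq> 0" for l
  proof (rule regular_cong)
    show "regular S ?q (\<lambda>x. 1 / l * inverse (z x))"
      by (rule regular_mult regular_const regular_inverse_factor[OF poly_fun_fst])+ simp
  qed (use that in \<open>auto simp: field_simps\<close>)
  show ?thesis unfolding scale_y1_def
    by (rule birational_inverse_chart[where q = ?q, OF q x0])
       (rule inv reg1 reg2 regular_poly poly_fun_fst | simp add: l)+
qed

lemma birational_inverse_scale_y2:
  assumes l: "l \<noteq> 0"
  shows "birational_inverse S S (scale_y2 l n) (scale_y2 (1 / l) (- n))"
proof -
  let ?q = "\<lambda>x. fst (snd x) * z x"
  let ?A = "\<lambda>l n x. (l * fst (snd x) powi n * z x + e0) / fst (snd x)"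
  obtain x0 where x0: "x0 \<in> S" "?q x0 \<noteq> 0" using ex_point by auto
  have q: "?q \<in> poly_fun" by (intro poly_fun_intros z1_poly)
  have inv: "?q (ch (?A l n x) (fst (snd x))) \<noteq> 0 \<and>
      ?A m k (ch (?A l n x) (fst (snd x))) = fst x \<and>
      fst (snd (ch (?A l n x) (fst (snd x)))) = fst (snd x)"
    if "?q x \<noteq> 0" "l * m = 1" "n + k = 0" for x l m n k
  proof -
    have eq: "z (ch (?A l n x) (fst (snd x))) = l * fst (snd x) powi n * z x"
      using that by (simp add: z1_eq)
    have "m * fst (snd x) powi k * (l * fst (snd x) powi n * z x) =
        (l * m) * (fst (snd x) powi n * fst (snd x) powi k) * z x" by algebra
    also have "fst (snd x) powi n * fst (snd x) powi k = 1"
      using that by (subst power_int_add[symmetric]) auto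
    finally have "m * fst (snd x) powi k * (l * fst (snd x) powi n * z x) = z x"
      using that by simp
    then have "?A m k (ch (?A l n x) (fst (snd x))) = (z x + e0) / fst (snd x)"
      by (simp only: eq fst_snd_chart)
    also have "\<dots> = fst x" using that by (simp add: z1_eq)
    finally have "?A m k (ch (?A l n x) (fst (snd x))) = fst x" .
    moreover have "l \<noteq> 0" using that by auto
    ultimately show ?thesis using that(1) by (simp only: eq fst_snd_chart) simp
  qed
  have pow: "regular S ?q (\<lambda>x. fst (snd x) powi n)" for n
    by (intro regular_power_int regular_poly poly_fun_fst_snd regular_inverse_factor[OF z1_poly]) auto
  have reg1: "regular S ?q (?A l n)" for l n
    by (intro regular_intros pow regular_inverse_factor[OF z1_poly]) auto
  have reg2: "regular S ?q (\<lambda>x. inverse (?A l n x * fst (snd x) - e0))" if "l \<noteq> 0" for l n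
  proof (rule regular_cong)
    show "regular S ?q (\<lambda>x. 1 / l * fst (snd x) powi (- n) * inverse (z x))"
      by (rule regular_mult regular_const pow regular_inverse_factor[OF poly_fun_fst_snd])+ simp
  qed (use that in \<open>auto simp: field_simps power_int_minus\<close>)
  show ?thesis unfolding scale_y2_def
    by (rule birational_inverse_chart[where q = ?q, OF q x0])
       (rule inv reg1 reg2 regular_poly poly_fun_fst_snd | simp add: l)+
qed

lemma birational_inverse_stokes: "birational_inverse S S stokes stokes_inv"
proof -
  let ?q = "\<lambda>x. fst x * fst (snd x) * z x"
  obtain x0 where x0: "x0 \<in> S" "?q x0 \<noteq> 0" using ex_point by auto
  have q: "?q \<in> poly_fun" by (intro poly_fun_intros z1_poly)
  have inv1: "regular S ?q (\<lambda>x. inverse (fst x))"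
    by (rule regular_inverse_factor[of "\<lambda>x. fst (snd x) * z x"])
       (auto intro!: poly_fun_intros z1_poly)
  have inv2: "regular S ?q (\<lambda>x. inverse (fst (snd x)))"
    by (rule regular_inverse_factor[of "\<lambda>x. fst x * z x"])
       (auto intro!: poly_fun_intros z1_poly)
  have invz: "regular S ?q (\<lambda>x. inverse (z x))"
    by (rule regular_inverse_factor[of "\<lambda>x. fst x * fst (snd x)"])
       (auto intro!: poly_fun_intros)
  have *: "?q (stokes x) \<noteq> 0 \<and> e0 / fst (snd (stokes x)) = fst x \<and>
      fst (stokes x) * (fst (snd (stokes x)))^2 / e0 = fst (snd x)"
    if "?q x \<noteq> 0" for x
    using that z_stokes[of x] e0 by (auto simp: stokes_def field_simps power2_eq_square)
  have **: "?q (stokes_inv x) \<noteq> 0 \<and> (fst (stokes_inv x))^2 * fst (snd (stokes_inv x)) / e0 = fst x \<and>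
      e0 / fst (stokes_inv x) = fst (snd x)"
    if "?q x \<noteq> 0" for x
    using that z_stokes_inv[of x] e0 by (auto simp: stokes_inv_def field_simps power2_eq_square)
  have r1: "regular S ?q (\<lambda>x. inverse ((fst x)^2 * fst (snd x) / e0 * (e0 / fst x) - e0))"
    by (rule regular_cong[OF invz]) (use e0 in \<open>auto simp: z1_eq power2_eq_square\<close>)
  have r2: "regular S ?q (\<lambda>x. inverse (e0 / fst (snd x) * (fst x * (fst (snd x))^2 / e0) - e0))"
    by (rule regular_cong[OF invz]) (use e0 in \<open>auto simp: z1_eq power2_eq_square\<close>)
  show ?thesis unfolding stokes_def stokes_inv_def
  proof (rule birational_inverse_chart[OF q x0])
    show "regular S ?q (\<lambda>x. (fst x)^2 * fst (snd x) / e0)"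
      "regular S ?q (\<lambda>x. fst x * (fst (snd x))^2 / e0)"
      unfolding divide_inverse by (intro regular_intros)+
    show "regular S ?q (\<lambda>x. e0 / fst x)" "regular S ?q (\<lambda>x. e0 / fst (snd x))"
      by (intro regular_divide regular_const inv1 inv2)+
  qed (use * ** r1 r2 in \<open>simp_all only: stokes_def stokes_inv_def, auto\<close>)
qed

section \<open>The involutions and the generators in coordinates\<close>

lemma sigma1_eq: "sigma1 e0 e3 e4 x = (- fst x - fst (snd x) * snd (snd x) + T1, snd x)"
  by (simp add: sigma1_def case_prod_unfold)

lemma sigma2_eq: "sigma2 e0 e3 e4 x =
    (fst x, - fst (snd x) - fst x * snd (snd x) + T2, snd (snd x))"
  by (simp add: sigma2_def case_prod_unfold)

abbreviation "sg1 \<equiv> sigma1 e0 e3 e4"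
abbreviation "sg2 \<equiv> sigma2 e0 e3 e4"

lemma sigma1_in_CV: "x \<in> S \<Longrightarrow> sg1 x \<in> S"
  by (cases x) (auto simp: sigma1_eq mem_CV algebra_simps power2_eq_square)

lemma sigma2_in_CV: "x \<in> S \<Longrightarrow> sg2 x \<in> S"
  by (cases x) (auto simp: sigma2_eq mem_CV algebra_simps power2_eq_square)

lemma sigma1_sigma1: "sg1 (sg1 x) = x" and sigma2_sigma2: "sg2 (sg2 x) = x"
  by (simp_all add: sigma1_eq sigma2_eq)

lemma birational_inverse_sigma1: "birational_inverse S S sg1 sg1"
proof (rule birational_inverse_regular[OF irreducible_CV irreducible_CV poly_fun.const[of 1] poly_fun.const[of 1]])
  show "ch 0 0 \<in> S" using e0 by (intro chart_in_CV) simp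
  show "regular_map S (\<lambda>_. 1) sg1"
    unfolding regular_map_def sigma1_eq fst_conv snd_conv
    by (intro conjI regular_poly poly_fun_intros)
  then show "regular_map S (\<lambda>_. 1) sg1" .
qed (simp_all add: sigma1_in_CV sigma1_sigma1)

lemma birational_inverse_sigma2: "birational_inverse S S sg2 sg2"
proof (rule birational_inverse_regular[OF irreducible_CV irreducible_CV poly_fun.const[of 1] poly_fun.const[of 1]])
  show "ch 0 0 \<in> S" using e0 by (intro chart_in_CV) simp
  show "regular_map S (\<lambda>_. 1) sg2"
    unfolding regular_map_def sigma2_eq fst_conv snd_conv
    by (intro conjI regular_poly poly_fun_intros)
  then show "regular_map S (\<lambda>_. 1) sg2" .
qed (simp_all add: sigma2_in_CV sigma2_sigma2)

lemma birational_inverse_g: "birational_inverse S S (sg1 \<circ> sg2) (sg2 \<circ> sg1)"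
  by (rule birational_inverse_comp[OF irreducible_CV irreducible_CV irreducible_CV
        birational_inverse_sigma2 birational_inverse_sigma1])

lemma birational_g: "birational S S (sg1 \<circ> sg2)"
  and birational_scale_y1: "l \<noteq> 0 \<Longrightarrow> birational S S (scale_y1 l)"
  and birational_scale_y2: "l \<noteq> 0 \<Longrightarrow> birational S S (scale_y2 l n)"
  and birational_stokes: "birational S S stokes"
  and birational_stokes_inv: "birational S S stokes_inv"
  using birational_inverse_g birational_inverse_scale_y1 birational_inverse_scale_y2
    birational_inverse_stokes birational_inverse_sym unfolding birational_def by blast+

lemma birational_o: "birational S S f \<Longrightarrow> birational S S g \<Longrightarrow> birational S S (f \<circ> g)"
  by (rule birational_comp[OF irreducible_CV])

lemma z2_poly: "z2 e0 e3 e4 \<in> poly_fun"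
  unfolding z2_def comp_def z1_eq sigma1_eq fst_conv snd_conv
  by (intro poly_fun_intros)

lemma z2_eq: "z2 e0 e3 e4 x = z (sg1 x)"
  by (simp add: z2_def)

text \<open>By Vieta, \<open>x\<^sub>1\<close> and its image \<open>x\<^sub>1'\<close> under \<open>\<sigma>\<^sub>1\<close> satisfy \<open>x\<^sub>1 + x\<^sub>1' = \<theta>\<^sub>1 - x\<^sub>2 x\<^sub>3\<close> and
  \<open>x\<^sub>1 x\<^sub>1' = x\<^sub>2\<^sup>2 - \<theta>\<^sub>2 x\<^sub>2 - e\<^sub>0 x\<^sub>3 + \<theta>\<^sub>4\<close>; in \<open>(x\<^sub>1 x\<^sub>2 - e\<^sub>0) (x\<^sub>1' x\<^sub>2 - e\<^sub>0)\<close> the terms with \<open>x\<^sub>3\<close> cancel.\<close>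

lemma z1_mult_z2: "x \<in> S \<Longrightarrow> z x * z2 e0 e3 e4 x = poly P2 (fst (snd x))"
proof -
  assume x: "x \<in> S"
  obtain a b c where abc: "x = (a, b, c)" by (cases x)
  have F: "a * b * c + a^2 + b^2 - T1 * a - T2 * b - e0 * c + T4 = 0"
    using x by (simp add: abc mem_CV algebra_simps)
  have "z x * z2 e0 e3 e4 x = (a * b - e0) * ((- a - b * c + T1) * b - e0)"
    by (simp add: abc z2_eq z1_eq sigma1_eq)
  also have "\<dots> = b^4 - T2 * b^3 + T4 * b^2 - e0 * T1 * b + e0^2"
    using F by algebra
  finally show ?thesis by (simp add: abc poly_P2)
qed

lemma generically_z2: "generically S (\<lambda>x. z2 e0 e3 e4 x \<noteq> 0)"
proof -
  obtain x where x: "x \<in> S" "z x \<noteq> 0" using generically_ex[OF irreducible_CV generically_z1] .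
  show ?thesis
    by (rule generically_nonzero[OF irreducible_CV z2_poly sigma1_in_CV[OF x(1)]])
       (use x in \<open>simp add: z2_eq sigma1_sigma1\<close>)
qed

lemma eq_if_y1_z1_eq:
  assumes "x \<in> S" "y \<in> S" "fst x * z x \<noteq> 0" "fst y * z y \<noteq> 0" "fst x = fst y" "z x = z y"
  shows "x = y"
proof -
  have "fst (snd x) = fst (snd y)" using assms by (simp add: z1_eq)
  then show ?thesis using CV_eq_chart[of x] CV_eq_chart[of y] assms by force
qed

lemma eq_if_z1_y2_eq:
  assumes "x \<in> S" "y \<in> S" "fst (snd x) * z x \<noteq> 0" "fst (snd y) * z y \<noteq> 0"
    "z x = z y" "fst (snd x) = fst (snd y)"
  shows "x = y"
proof -
  have "fst x = fst y" using assms by (simp add: z1_eq)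
  then show ?thesis using CV_eq_chart[of x] CV_eq_chart[of y] assms by force
qed

text \<open>The involution \<open>\<sigma>\<^sub>1\<close> carries the pair \<open>(y\<^sub>2, z\<^sub>2)\<close> to \<open>(y\<^sub>2, z\<^sub>1)\<close>.\<close>

lemma eq_if_y2_z2_eq:
  assumes "x \<in> S" "y \<in> S" "fst (snd x) * z2 e0 e3 e4 x \<noteq> 0" "fst (snd y) * z2 e0 e3 e4 y \<noteq> 0"
    "fst (snd x) = fst (snd y)" "z2 e0 e3 e4 x = z2 e0 e3 e4 y"
  shows "x = y"
proof -
  have s: "fst (snd (sg1 u)) = fst (snd u)" for u by (simp add: sigma1_eq)
  have "sg1 x = sg1 y"
    by (rule eq_if_z1_y2_eq) (use assms in \<open>simp_all add: z2_eq s sigma1_in_CV\<close>)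
  then show ?thesis using sigma1_sigma1 by metis
qed

lemma map_in_y1_z1:
  assumes "birational S S f" "generically S (\<lambda>x. (fst (f x), z (f x)) = AB (fst x) (z x))"
  shows "map_in_coords S y1 z AB = cls f"
proof -
  obtain x0 where x0: "x0 \<in> S" "fst x0 * z x0 \<noteq> 0" using ex_point by auto
  show ?thesis
    by (rule map_in_coords_eq[where q = "\<lambda>x. fst x * z x", OF irreducible_CV assms(1) _ x0])
       (use assms(2) eq_if_y1_z1_eq in \<open>auto simp: y1_eq intro!: poly_fun_intros z1_poly\<close>)
qed

lemma map_in_z1_y2:
  assumes "birational S S f"
    and "generically S (\<lambda>x. (z (f x), fst (snd (f x))) = AB (z x) (fst (snd x)))"
  shows "map_in_coords S z y2 AB = cls f"
proof -
  obtain x0 where x0: "x0 \<in> S" "fst (snd x0) * z x0 \<noteq> 0" using ex_point by auto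
  show ?thesis
    by (rule map_in_coords_eq[where q = "\<lambda>x. fst (snd x) * z x", OF irreducible_CV assms(1) _ x0])
       (use assms(2) eq_if_z1_y2_eq in \<open>auto simp: y2_eq intro!: poly_fun_intros z1_poly\<close>)
qed

lemma map_in_y2_z2:
  assumes "birational S S f"
    and "generically S (\<lambda>x. (fst (snd (f x)), z2 e0 e3 e4 (f x)) =
      AB (fst (snd x)) (z2 e0 e3 e4 x))"
  shows "map_in_coords S y2 (z2 e0 e3 e4) AB = cls f"
proof -
  obtain x0 where x0: "x0 \<in> S" "fst (snd x0) * z2 e0 e3 e4 x0 \<noteq> 0"
    using generically_ex[OF irreducible_CV generically_conj[OF generically_y2 generically_z2]]
    by (metis mult_eq_0_iff)
  show ?thesis
    by (rule map_in_coords_eq[where q = "\<lambda>x. fst (snd x) * z2 e0 e3 e4 x", OF irreducible_CV assms(1) _ x0])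
       (use assms(2) eq_if_y2_z2_eq in \<open>auto simp: y2_eq intro!: poly_fun_intros z2_poly\<close>)
qed

lemma T_y1_eq: "T_y1 e0 e3 e4 = {cls (scale_y1 l) |l. l \<noteq> 0}"
proof -
  have "map_in_coords S y1 z (\<lambda>y z. (y, l * z)) = cls (scale_y1 l)" if "l \<noteq> 0" for l
    by (rule map_in_y1_z1[OF birational_scale_y1[OF that]], rule generically_mono[OF generically_y1])
       (simp add: z_scale_y1, simp add: scale_y1_def)
  then show ?thesis unfolding T_y1_def by (intro Collect_cong) auto
qed

lemma s1_eq: "s1 e0 e3 e4 = cls stokes"
  unfolding s1_def
  by (rule map_in_y1_z1[OF birational_stokes], rule generically_mono[OF generically_y1])
     (use e0 in \<open>simp add: z_stokes, simp add: stokes_def z1_eq field_simps power2_eq_square\<close>)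

lemma scale_y2_z1_y2_eq:
  "map_in_coords S z y2 (\<lambda>z y. (z * y^2, y)) = cls (scale_y2 1 2)"
  by (rule map_in_z1_y2[OF birational_scale_y2], simp, rule generically_mono[OF generically_y2])
     (simp add: z_scale_y2, simp add: scale_y2_def)

lemma m_half_eq: "m_half e0 e3 e4 = cls (scale_y2 e0 (- 2))"
  unfolding m_half_def
proof (rule map_in_y2_z2[OF birational_scale_y2[OF e0]],
    rule generically_conj2[OF generically_y2 generically_z1])
  fix x assume x: "x \<in> S" "fst (snd x) \<noteq> 0" "z x \<noteq> 0"
  let ?y = "scale_y2 e0 (- 2) x"
  have z: "z ?y = e0 * z x / (fst (snd x))^2"
    using x by (simp add: z_scale_y2 power_int_minus field_simps)
  have y: "fst (snd ?y) = fst (snd x)" by (simp add: scale_y2_def)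
  have "z ?y \<noteq> 0" using x z e0 by simp
  then have "?y \<in> S" unfolding scale_y2_def by (intro chart_in_CV) (auto simp: z1_eq)
  from z1_mult_z2[OF this] have "z ?y * z2 e0 e3 e4 ?y = z x * z2 e0 e3 e4 x"
    by (simp add: y z1_mult_z2 x)
  then have "z2 e0 e3 e4 ?y = inverse e0 * (fst (snd x))^2 * z2 e0 e3 e4 x"
    using x e0 by (simp add: z field_simps)
  then show "(fst (snd ?y), z2 e0 e3 e4 ?y) =
    (fst (snd x), inverse e0 * (fst (snd x))^2 * z2 e0 e3 e4 x)" by (simp add: y)
qed

section \<open>Relations between the generators\<close>

lemma scale_y1_mult:
  assumes "l \<noteq> 0" "m \<noteq> 0"
  shows "cls (scale_y1 l) \<otimes>\<^bsub>G\<^esub> cls (scale_y1 m) = cls (scale_y1 (l * m))"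
  unfolding cls_mult[OF assms[THEN birational_scale_y1]]
  by (rule cls_eqI, rule generically_mono[OF generically_y1])
     (simp add: z_scale_y1 scale_y1_def[of l] scale_y1_def[of "l * m"], simp add: scale_y1_def mult.assoc)

lemma scale_y2_mult:
  assumes "l \<noteq> 0" "m \<noteq> 0"
  shows "cls (scale_y2 l i) \<otimes>\<^bsub>G\<^esub> cls (scale_y2 m j) = cls (scale_y2 (l * m) (i + j))"
  unfolding cls_mult[OF assms[THEN birational_scale_y2]]
  by (rule cls_eqI, rule generically_mono[OF generically_y2])
     (simp add: z_scale_y2 scale_y2_def[of l] scale_y2_def[of "l * m"],
      simp add: scale_y2_def power_int_add mult_ac)

text \<open>Since \<open>s\<^sub>1\<close> pulls \<open>x\<^sub>2\<close> back to \<open>e\<^sub>0 / x\<^sub>1\<close> and fixes \<open>z\<^sub>1\<close>, it conjugates the torus fixing \<open>x\<^sub>1\<close> to the torus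
  fixing \<open>x\<^sub>2\<close>.\<close>

lemma stokes_scale_y1:
  assumes "l \<noteq> 0"
  shows "cls stokes \<otimes>\<^bsub>G\<^esub> cls (scale_y1 l) = cls (scale_y2 l 0) \<otimes>\<^bsub>G\<^esub> cls stokes"
  unfolding cls_mult[OF birational_stokes birational_scale_y1[OF assms]]
    cls_mult[OF birational_scale_y2[OF assms] birational_stokes]
proof (rule cls_eqI, rule generically_mono[OF generically_y1])
  fix x :: point assume "fst x \<noteq> 0"
  then show "(stokes \<circ> scale_y1 l) x = (scale_y2 l 0 \<circ> stokes) x"
    using e0 by (simp add: scale_y2_def z_stokes) (simp add: stokes_def scale_y1_def power2_eq_square mult.commute)
qed

text \<open>The counterpart of \<open>z1_mult_z2\<close> for \<open>\<sigma>\<^sub>2\<close>.  Writing \<open>P1\<close> for the polynomial on the right, one has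
  \<open>b\<^sup>4 P1 (e\<^sub>0 / b) = e\<^sub>0\<^sup>2 P2 b\<close>, which is behind the formula for \<open>s\<^sub>2\<close> below.\<close>

lemma z1_mult_z1_sigma2:
  assumes "x \<in> S"
  shows "z x * z (sg2 x) = fst x^4 - T1 * fst x^3 + T4 * fst x^2 - e0 * T2 * fst x + e0^2"
proof -
  obtain a b c where abc: "x = (a, b, c)" by (cases x)
  have F: "a * b * c + a^2 + b^2 - T1 * a - T2 * b - e0 * c + T4 = 0"
    using assms by (simp add: abc mem_CV algebra_simps)
  have "z x * z (sg2 x) = (a * b - e0) * (a * (- b - a * c + T2) - e0)"
    by (simp add: abc z1_eq sigma2_eq)
  also have "\<dots> = a^4 - T1 * a^3 + T4 * a^2 - e0 * T2 * a + e0^2"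
    using F by algebra
  finally show ?thesis by (simp add: abc)
qed

text \<open>That is, \<open>s\<^sub>2 = g s\<^sub>1\<inverse> m m\<close>.  Let \<open>y\<close> be the image of \<open>x\<close> under \<open>s\<^sub>1\<inverse> m m\<close>; its first coordinate is
  \<open>e\<^sub>0 / b\<close> and its \<open>z\<close> is \<open>e\<^sub>0\<^sup>2 z / b\<^sup>4\<close>.  The symmetry between \<open>P1\<close> and \<open>P2\<close> turns the product
  \<open>z y * z (\<sigma>\<^sub>2 y)\<close> into \<open>(e\<^sub>0\<^sup>2 / b\<^sup>4) z\<^sub>1 z\<^sub>2\<close>, so that \<open>z (\<sigma>\<^sub>2 y) = z\<^sub>2\<close>; this is the required value of
  \<open>z\<^sub>2\<close> after \<open>g\<close>, and it determines the new \<open>x\<^sub>2\<close>.\<close>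

lemma s2_eq:
  "s2 e0 e3 e4 = cls (sg1 \<circ> sg2) \<otimes>\<^bsub>G\<^esub> cls stokes_inv \<otimes>\<^bsub>G\<^esub> cls (scale_y2 (e0 * e0) (- 4))"
proof -
  have m: "birational S S (scale_y2 (e0 * e0) (- 4))" using e0 by (simp add: birational_scale_y2)
  let ?y = "\<lambda>x. stokes_inv (scale_y2 (e0 * e0) (- 4) x)"
  let ?f = "sg1 \<circ> sg2 \<circ> stokes_inv \<circ> scale_y2 (e0 * e0) (- 4)"
  have "s2 e0 e3 e4 = cls ?f"
    unfolding s2_def
  proof (rule map_in_y2_z2, goal_cases)
    case 1 show ?case by (intro birational_o birational_g birational_stokes_inv m)
  next
    case 2
    show ?case
    proof (rule generically_conj2[OF generically_y2 generically_z1])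
      fix x assume x: "x \<in> S" "fst (snd x) \<noteq> 0" "z x \<noteq> 0"
      let ?b = "fst (snd x)"
      have b: "fst (snd (scale_y2 (e0 * e0) (- 4) x)) = ?b" by (simp add: scale_y2_def)
      have y: "fst (?y x) = e0 / ?b" by (simp add: stokes_inv_def b)
      have zy: "z (?y x) = e0^2 * z x / ?b^4"
        using x by (simp add: z_stokes_inv b z_scale_y2 power_int_minus field_simps power2_eq_square)
      have "z (?y x) \<noteq> 0" using x e0 by (simp add: zy)
      then have yS: "?y x \<in> S" unfolding stokes_inv_def by (intro chart_in_CV) (auto simp: z1_eq)
      have "?b^4 * (z (?y x) * z (sg2 (?y x))) = e0^2 * poly P2 ?b"
        unfolding z1_mult_z1_sigma2[OF yS] y poly_P2 using x(2)
        by (simp add: field_simps power2_eq_square power3_eq_cube power4_eq_xxxx)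
      also have "\<dots> = e0^2 * (z x * z2 e0 e3 e4 x)" by (simp add: z1_mult_z2 x)
      finally have z3: "z (sg2 (?y x)) = z2 e0 e3 e4 x"
        using x e0 by (simp add: zy)
      have "e0 / ?b * fst (snd (sg2 (?y x))) - e0 = z (sg2 (?y x))"
        by (simp add: z1_eq sigma2_eq y)
      then have "fst (snd (sg2 (?y x))) = ?b * (1 + inverse e0 * z2 e0 e3 e4 x)"
        using x e0 unfolding z3 by (simp add: field_simps)
      then show "(fst (snd (?f x)), z2 e0 e3 e4 (?f x)) =
        (?b * (1 + inverse e0 * z2 e0 e3 e4 x), z2 e0 e3 e4 x)"
        using z3 by (simp add: z2_eq sigma1_sigma1) (simp add: sigma1_eq)
    qed
  qed
  then show ?thesis
    unfolding cls_mult[OF birational_g birational_stokes_inv]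
      cls_mult[OF birational_o[OF birational_g birational_stokes_inv] m] .
qed

end

section \<open>The confluent maps\<close>

locale confluence = cubic_surface +
  fixes k :: complex
  assumes k: "k \<noteq> 0"
begin

abbreviation "S' \<equiv> CVI e0 e3 e4 k"
abbreviation "\<Phi> \<equiv> Phi e0 e3 e4 k"

text \<open>For fixed \<open>x\<^sub>3\<close> the map \<open>\<Phi>\<close> is affine in \<open>(x\<^sub>1, x\<^sub>2)\<close>; this is its determinant, multiplied by
  \<open>e\<^sub>0\<^sup>2 \<kappa>\<^sup>2\<close> to clear denominators.\<close>

definition fibre_det :: "point \<Rightarrow> complex" where
  "fibre_det x = e0 * k^2 * snd (snd x) - k^4 - e0^2"

lemma fibre_det_poly: "fibre_det \<in> poly_fun"
  unfolding fibre_det_def[abs_def] by (intro poly_fun_intros)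

lemma fibre_det_Phi: "fibre_det (\<Phi> x) = fibre_det x"
  by (simp add: fibre_det_def Phi_def case_prod_unfold)

text \<open>Fibre by fibre, \<open>\<Phi>\<close> transforms the equation of one conic into that of the other up to the
  determinant, so away from the zeros of the determinant it is a bijection of the two surfaces.\<close>

lemma equation_Phi:
  fixes a b c :: complex
  defines "X1 \<equiv> fst (\<Phi> (a, b, c))" and "X2 \<equiv> fst (snd (\<Phi> (a, b, c)))"
  shows "e0^2 * k^2 * (X1 * X2 * c + X1^2 + X2^2 + c^2
     - Theta1 e0 e3 e4 k * X1 - Theta2 e0 e3 e4 k * X2 - Theta3 e0 e3 e4 k * c
     + Theta4 e0 e3 e4 k) =
   - fibre_det (a, b, c) * ((a * b - e0) * c + (a^2 + b^2 - T1 * a - T2 * b + T4))"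
proof -
  define K E where "K = inverse k" and "E = inverse e0"
  have K: "k * K = 1" and E: "e0 * E = 1" using k e0 by (simp_all add: K_def E_def)
  have X: "X1 = E * k * a + K * b"
    "X2 = - E * k * a * c + K * a - E * k * b + par e3 * k + par e4 * E * k"
    by (simp_all add: X1_def X2_def Phi_def K_def E_def)
  show ?thesis unfolding X theta_expand Theta_expand fibre_det_def snd_conv K_def[symmetric] E_def[symmetric]
    using K E by algebra
qed

text \<open>Cramer's rule for the affine map in the fibre.\<close>

definition Psi :: "point \<Rightarrow> point" where
  "Psi X = (let r = fst (snd X) - par e3 * k - par e4 * inverse e0 * k;
                d = e0^2 * k^2 * inverse (fibre_det X)
            in (d * (- fst X * inverse e0 * k - inverse k * r),
                d * (inverse e0 * k * r - (inverse k - inverse e0 * k * snd (snd X)) * fst X),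
                snd (snd X)))"

lemma fibre_det_Psi: "fibre_det (Psi x) = fibre_det x"
  by (simp add: fibre_det_def Psi_def Let_def)

lemma Psi_Phi: "fibre_det x \<noteq> 0 \<Longrightarrow> Psi (\<Phi> x) = x"
proof -
  assume d: "fibre_det x \<noteq> 0"
  obtain a b c where x: "x = (a, b, c)" by (cases x)
  define K E D where "K = inverse k" and "E = inverse e0" and "D = inverse (fibre_det x)"
  have K: "k * K = 1" and E: "e0 * E = 1" and D: "(e0 * k^2 * c - k^4 - e0^2) * D = 1"
    using k e0 d by (simp_all add: K_def E_def D_def fibre_det_def x)
  show ?thesis unfolding Psi_def fibre_det_Phi Let_def D_def[symmetric]
    unfolding Phi_def x prod.case fst_conv snd_conv K_def[symmetric] E_def[symmetric] prod.inject
  proof (intro conjI refl)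
    show "e0^2 * k^2 * D * (- (E * k * a + K * b) * E * k - K * (- E * k * a * c + K * a - E * k * b +
      par e3 * k + par e4 * E * k - par e3 * k - par e4 * E * k)) = a"
      using K E D by algebra
    show "e0^2 * k^2 * D * (E * k * (- E * k * a * c + K * a - E * k * b +
      par e3 * k + par e4 * E * k - par e3 * k - par e4 * E * k) -
      (K - E * k * c) * (E * k * a + K * b)) = b"
      using K E D by algebra
  qed
qed

lemma Phi_Psi: "fibre_det x \<noteq> 0 \<Longrightarrow> \<Phi> (Psi x) = x"
proof -
  assume d: "fibre_det x \<noteq> 0"
  obtain a b c where x: "x = (a, b, c)" by (cases x)
  define K E D where "K = inverse k" and "E = inverse e0" and "D = inverse (fibre_det x)"
  have K: "k * K = 1" and E: "e0 * E = 1" and D: "(e0 * k^2 * c - k^4 - e0^2) * D = 1"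
    using k e0 d by (simp_all add: K_def E_def D_def fibre_det_def x)
  define A where "A = e0^2 * k^2 * D * (- a * E * k - K * (b - par e3 * k - par e4 * E * k))"
  define B where "B = e0^2 * k^2 * D * (E * k * (b - par e3 * k - par e4 * E * k) -
      (K - E * k * c) * a)"
  have Psi: "Psi x = (A, B, c)" unfolding Psi_def Let_def D_def[symmetric] A_def B_def
    by (simp add: x K_def E_def)
  show ?thesis unfolding Psi unfolding Phi_def x prod.case K_def[symmetric] E_def[symmetric] prod.inject
  proof (intro conjI refl)
    show "E * k * A + K * B = a" unfolding A_def B_def using K E D by algebra
    show "- E * k * A * c + K * A - E * k * B + par e3 * k + par e4 * E * k = b"
      unfolding A_def B_def using K E D by algebra
  qed
qed

lemma Phi_in_CVI: "x \<in> S \<Longrightarrow> \<Phi> x \<in> S'"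
proof -
  assume x: "x \<in> S"
  obtain a b c where abc: "x = (a, b, c)" by (cases x)
  have "\<Phi> x = (fst (\<Phi> x), fst (snd (\<Phi> x)), c)" by (simp add: abc Phi_def)
  moreover have "(fst (\<Phi> x), fst (snd (\<Phi> x)), c) \<in> S'"
    using equation_Phi[of a b c] x k e0 unfolding abc mem_CVI mem_CV by simp
  ultimately show ?thesis by simp
qed

lemma Psi_in_CV: "x \<in> S' \<Longrightarrow> fibre_det x \<noteq> 0 \<Longrightarrow> Psi x \<in> S"
proof -
  assume x: "x \<in> S'" and d: "fibre_det x \<noteq> 0"
  obtain a b c where abc: "Psi x = (a, b, c)" by (cases "Psi x")
  have Phi: "\<Phi> (a, b, c) = x" using Phi_Psi[OF d] by (simp add: abc)
  have "x = (fst (\<Phi> (a, b, c)), fst (snd (\<Phi> (a, b, c))), c)"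
    unfolding Phi[symmetric] by (simp add: Phi_def)
  then have "(fst (\<Phi> (a, b, c)), fst (snd (\<Phi> (a, b, c))), c) \<in> S'" using x by simp
  moreover have "fibre_det (a, b, c) \<noteq> 0" using d fibre_det_Psi[of x] by (simp add: abc)
  ultimately show ?thesis using equation_Phi[of a b c] unfolding abc mem_CVI mem_CV by simp
qed

text \<open>The same continuity argument as for the first surface: now \<open>x\<^sub>2\<close> is kept and \<open>x\<^sub>3\<close> moves.\<close>

lemma poly_fun_dense_CVI:
  assumes p: "p \<in> poly_fun" and zero: "\<And>x. x \<in> S' \<Longrightarrow> fibre_det x \<noteq> 0 \<Longrightarrow> p x = 0" and "x \<in> S'"
  shows "p x = 0"
proof -
  obtain a b c where x: "x = (a, b, c)" by (cases x)
  let ?B = "\<lambda>t. b * t - Theta1 e0 e3 e4 k"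
  let ?C = "\<lambda>t. b^2 + t^2 - Theta2 e0 e3 e4 k * b - Theta3 e0 e3 e4 k * t + Theta4 e0 e3 e4 k"
  have "a^2 + ?B c * a + ?C c = 0"
    using \<open>x \<in> S'\<close> unfolding x mem_CVI by (simp add: algebra_simps)
  moreover have "(?B \<longlongrightarrow> ?B c) (at c)" "(?C \<longlongrightarrow> ?C c) (at c)"
    by (intro tendsto_intros)+
  ultimately obtain X where X: "\<And>t. (X t)^2 + ?B t * X t + ?C t = 0" and lim: "(X \<longlongrightarrow> a) (at c)"
    by (rule quadratic_root_tendsto) blast
  have S: "(X t, b, t) \<in> S'" for t
    using X[of t] unfolding mem_CVI by (simp add: algebra_simps)
  have "[:- (k^4 + e0^2), e0 * k^2:] \<noteq> 0" using e0 k by simp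
  (* this polynomial in t is the determinant at a point with third coordinate t *)
  then have "eventually (\<lambda>t. p (X t, b, t) = 0) (at c)"
    by (rule eventually_mono[OF poly_nonzero_eventually_at])
       (use zero S in \<open>simp add: fibre_det_def algebra_simps\<close>)
  from poly_fun_closed_condition[OF p lim tendsto_const tendsto_ident_at _ this]
  show ?thesis by (simp add: x)
qed

lemma Phi_poly: "(\<lambda>x. fst (\<Phi> x)) \<in> poly_fun" "(\<lambda>x. fst (snd (\<Phi> x))) \<in> poly_fun"
  "(\<lambda>x. snd (snd (\<Phi> x))) \<in> poly_fun"
  unfolding Phi_def case_prod_unfold fst_conv snd_conv by (intro poly_fun_intros)+

lemma irreducible_CVI: "irreducible_set S'"
  unfolding irreducible_set_def
proof (intro conjI ballI impI)
  have "ch 0 0 \<in> S" using e0 by (intro chart_in_CV) auto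
  then show "S' \<noteq> {}" using Phi_in_CVI by blast
next
  fix p q assume p: "p \<in> poly_fun" and q: "q \<in> poly_fun" and pq: "\<forall>x\<in>S'. p x * q x = 0"
  have *: "\<forall>x\<in>S'. p x = 0" if p: "p \<in> poly_fun" and zero: "\<forall>x\<in>S. p (\<Phi> x) = 0" for p
  proof
    fix x assume x: "x \<in> S'"
    show "p x = 0"
    proof (rule poly_fun_dense_CVI[OF p _ x])
      fix y assume y: "y \<in> S'" "fibre_det y \<noteq> 0"
      show "p y = 0" using zero Psi_in_CV[OF y] Phi_Psi[OF y(2)] by force
    qed
  qed
  have "(\<forall>x\<in>S. p (\<Phi> x) = 0) \<or> (\<forall>x\<in>S. q (\<Phi> x) = 0)"
    by (rule irreducible_setD[OF irreducible_CV poly_fun_comp[OF p Phi_poly] poly_fun_comp[OF q Phi_poly]])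
       (use pq Phi_in_CVI in blast)
  then show "(\<forall>x\<in>S'. p x = 0) \<or> (\<forall>x\<in>S'. q x = 0)" using *[OF p] *[OF q] by blast
qed

text \<open>At the points \<open>chart 0 t\<close> the function is a quadratic polynomial in \<open>t\<close>; its second difference is
  nonzero.\<close>

lemma ex_fibre_det: "\<exists>x\<in>S. fibre_det x \<noteq> 0"
proof (rule ccontr)
  assume "\<not> ?thesis"
  then have d: "fibre_det x = 0" if "x \<in> S" for x using that by blast
  have in0: "ch 0 t \<in> S" for t using e0 by (intro chart_in_CV) simp
  have "fibre_det (ch 0 t) = k^2 * (t^2 - T2 * t + T4) - k^4 - e0^2" for t
    using e0 by (simp add: fibre_det_def chart_def) (simp add: algebra_simps)
  then have *: "k^2 * (t^2 - T2 * t + T4) - k^4 - e0^2 = 0" for t using d[OF in0] by metis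
  define f where "f t = k^2 * (t^2 - T2 * t + T4) - k^4 - e0^2" for t
  have "2 * k^2 = f 1 + f (-1) - 2 * f 0" by (simp add: f_def algebra_simps)
  also have "\<dots> = 0" unfolding f_def * by simp
  finally show False using k by simp
qed

lemma birational_inverse_Phi: "birational_inverse S S' \<Phi> Psi"
proof -
  obtain x0 where x0: "x0 \<in> S" "fibre_det x0 \<noteq> 0" using ex_fibre_det by blast
  show ?thesis
  proof (rule birational_inverse_regular[OF irreducible_CV irreducible_CVI fibre_det_poly fibre_det_poly x0])
    show "regular_map S fibre_det \<Phi>"
      unfolding regular_map_def using Phi_poly by (blast intro: regular_poly)
    have inv: "regular S' fibre_det (\<lambda>x. inverse (fibre_det x))"
      by (rule regular_inverse_factor[OF poly_fun.const[of 1]]) simp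
    show "regular_map S' fibre_det Psi"
      unfolding regular_map_def Psi_def Let_def fst_conv snd_conv
      by (intro conjI regular_mult regular_const inv regular_poly poly_fun_intros)
  qed (simp_all add: fibre_det_Phi fibre_det_Psi Psi_Phi Phi_Psi Phi_in_CVI Psi_in_CV)
qed

text \<open>A representative of the inverse of \<open>\<Phi>\<close> chosen by \<open>inverse_map\<close> need not be \<open>Psi\<close>, but it undoes \<open>\<Phi>\<close> at the
  generic point, and so also at the image of the generic point under the birational map \<open>f\<close>.\<close>

lemma conj_Phi_eq:
  assumes f: "birational S S f" and eq: "generically S (\<lambda>x. h (\<Phi> x) = \<Phi> (f x))"
  shows "conj_Phi e0 e3 e4 k h = cls f"
proof -
  define \<Psi> where "\<Psi> = inverse_map S S' \<Phi>"
  have "birational_inverse S S' \<Phi> \<Psi>"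
    unfolding \<Psi>_def inverse_map_def by (rule someI[of "birational_inverse S S' \<Phi>", OF birational_inverse_Phi])
  then have "generically S (\<lambda>x. \<Psi> (\<Phi> x) = x)" by (simp add: birational_inverse_def)
  then have "generically S (\<lambda>x. \<Psi> (\<Phi> (f x)) = f x)"
    by (rule generically_comp_birational[OF irreducible_CV f])
  then have "generically S (\<lambda>x. (\<Psi> \<circ> h \<circ> \<Phi>) x = f x)"
    using eq by (rule generically_conj2) simp
  then show ?thesis unfolding conj_Phi_def \<Psi>_def[symmetric] by (rule cls_eqI)
qed

lemma h12_Phi: "h12 e0 e3 e4 k (\<Phi> x) = \<Phi> ((sg2 \<circ> sg1) x)"
proof -
  obtain a b c where x: "x = (a, b, c)" by (cases x)
  define K E where "K = inverse k" and "E = inverse e0"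
  have K: "k * K = 1" and E: "e0 * E = 1" using k e0 by (simp_all add: K_def E_def)
  show ?thesis
    unfolding x o_def sigma1_eq sigma2_eq fst_conv snd_conv h12_def Phi_def prod.case Theta_expand theta_expand
      K_def[symmetric] E_def[symmetric] prod.inject
    apply (intro conjI refl)
    using K E apply algebra
    using K E apply algebra
    done
qed

lemma conj_h12: "conj_Phi e0 e3 e4 k (h12 e0 e3 e4 k) = cls (sg2 \<circ> sg1)"
  using birational_inverse_sym[OF birational_inverse_g]
  by (intro conj_Phi_eq generically_everywhere h12_Phi) (auto simp: birational_def)

text \<open>Each \<open>h\<^sub>i\<^sub>j\<close> is the composition of the two Vieta involutions in the coordinates \<open>i\<close> and \<open>j\<close>, so the cyclic
  product telescopes, on the whole of affine space.\<close>

lemma h31_h12_h23: "h31 e0 e3 e4 k (h12 e0 e3 e4 k (h23 e0 e3 e4 k x)) = x"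
  by (cases x) (simp add: h31_def h12_def h23_def algebra_simps power2_eq_square)

text \<open>The inverse of the conjugate of \<open>h23\<close>.\<close>

definition twist :: "point \<Rightarrow> point" where
  "twist = scale_y1 (k^2 / e0) \<circ> stokes_inv \<circ> scale_y2 e0 (- 2)"

text \<open>The first coordinate of \<open>\<Phi>\<close> takes the same value at \<open>x\<close> and at \<open>twist x\<close>, as it must, since \<open>h23\<close>
  fixes that coordinate.\<close>

lemma twist_eq:
  assumes "fst (snd x) \<noteq> 0"
  shows "twist x = ch (e0 / fst (snd x)) (fst (snd x) + k^2 * z x / (e0 * fst (snd x)))"
proof -
  let ?b = "fst (snd x)"
  let ?m = "scale_y2 e0 (- 2) x"
  have b: "fst (snd ?m) = ?b" by (simp add: scale_y2_def)
  have "z (stokes_inv ?m) = e0 * z x / ?b^2"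
    using assms by (simp add: z_stokes_inv b z_scale_y2 power_int_minus field_simps)
  moreover have "fst (stokes_inv ?m) = e0 / ?b" by (simp add: stokes_inv_def b)
  ultimately have "twist x = ch (e0 / ?b) ((k^2 / e0 * (e0 * z x / ?b^2) + e0) / (e0 / ?b))"
    by (simp add: twist_def scale_y1_def)
  also have "(k^2 / e0 * (e0 * z x / ?b^2) + e0) / (e0 / ?b) = ?b + k^2 * z x / (e0 * ?b)"
    using assms e0 by (simp add: field_simps power2_eq_square)
  finally show ?thesis .
qed

lemma birational_twist: "birational S S twist"
  unfolding twist_def using e0 k
  by (intro birational_o birational_scale_y1 birational_scale_y2 birational_stokes_inv) auto

text \<open>Although \<open>twist\<close> has poles, all coordinates of its composition with \<open>\<Phi>\<close> are polynomials.  The reason is that,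
  with the new coordinates \<open>A\<close> and \<open>B\<close> in place of \<open>x\<^sub>1\<close> and \<open>x\<^sub>2\<close>, the terms of the surface equation free of
  \<open>x\<^sub>3\<close> sum to \<open>P2 b\<close> plus a multiple of \<open>z\<close>, up to the factor \<open>b\<^sup>2\<close>, and \<open>P2 b = z\<^sub>1 z\<^sub>2\<close> is itself
  divisible by \<open>z\<close>.\<close>

lemma Phi_twist:
  assumes "(a, b, c) \<in> S" "b \<noteq> 0" "a * b \<noteq> e0"
  defines "K \<equiv> inverse k" and "E \<equiv> inverse e0" and "a' \<equiv> - a - b * c + T1"
  shows "\<Phi> (twist (a, b, c)) = (E * k * a + K * b, K * a' + k * E * b,
     - (K^2 * (a' * b - e0) + 2 * b^2 * E + k^2 * E^2 * (a * b - e0) - T2 * b * E))"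
proof -
  define u where "u = inverse b"
  define v where "v = inverse (a * b - e0)"
  have K: "k * K = 1" and E: "e0 * E = 1" and u: "b * u = 1" and v: "(a * b - e0) * v = 1"
    using k e0 assms by (simp_all add: K_def E_def u_def v_def)
  define A where "A = e0 * u"
  define B where "B = b + k^2 * (a * b - e0) * (E * u)"
  define C where "C = - (A^2 + B^2 - T1 * A - T2 * B + T4) * (v * K^2 * b^2)"
  have AB: "A * B - e0 = k^2 * (a * b - e0) * u^2"
    unfolding A_def B_def using E u by algebra
  have inv: "inverse (A * B - e0) = v * K^2 * b^2"
    unfolding AB by (simp add: v_def K_def u_def power_inverse mult_ac)
  have tw: "twist (a, b, c) = (A, B, C)"
    using assms(2)
    by (subst twist_eq)
       (simp_all add: chart_def z1_eq A_def[symmetric] B_def[symmetric] divide_inverse E_def[symmetric]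
         u_def[symmetric] inv C_def)
  have C: "C = - (K^2 * (a' * b - e0) + 2 * b^2 * E + k^2 * E^2 * (a * b - e0) - T2 * b * E)"
  proof -
    have "b^2 * (A^2 + B^2 - T1 * A - T2 * B + T4) = poly P2 b + (a * b - e0) *
        (2 * b^2 * k^2 * E + k^4 * E^2 * (a * b - e0) - T2 * b * k^2 * E)"
      unfolding A_def B_def poly_P2 using E u by algebra
    also have "poly P2 b = (a * b - e0) * (a' * b - e0)"
      using z1_mult_z2[OF assms(1)] by (simp add: z1_eq z2_eq sigma1_eq a'_def)
    finally have "b^2 * (A^2 + B^2 - T1 * A - T2 * B + T4) = (a * b - e0) * (a' * b - e0) + (a * b - e0) *
        (2 * b^2 * k^2 * E + k^4 * E^2 * (a * b - e0) - T2 * b * k^2 * E)" .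
    then show ?thesis unfolding C_def using K v by algebra
  qed
  have X1: "E * k * A + K * B = E * k * a + K * b"
    unfolding A_def B_def using E K u by algebra
  have X2: "- E * k * A * C + K * A - E * k * B + par e3 * k + par e4 * E * k = K * a' + k * E * b"
    unfolding A_def B_def C theta_expand using E K u by algebra
  show ?thesis
    unfolding tw using X1 X2 C by (simp add: Phi_def K_def E_def)
qed

text \<open>The third coordinate comes down to the product formula for \<open>x\<^sub>1 x\<^sub>1'\<close>; given it, the second is linear
  in the remaining terms.\<close>

lemma h23_Phi_twist:
  assumes "x \<in> S" "fst (snd x) \<noteq> 0" "z x \<noteq> 0"
  shows "h23 e0 e3 e4 k (\<Phi> (twist x)) = \<Phi> x"
proof -
  obtain a b c where x: "x = (a, b, c)" by (cases x)
  define K E a' where "K = inverse k" and "E = inverse e0" and "a' = - a - b * c + T1"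
  define C where "C = - (K^2 * (a' * b - e0) + 2 * b^2 * E + k^2 * E^2 * (a * b - e0) - T2 * b * E)"
  define X1 X2 where "X1 = E * k * a + K * b" and "X2 = K * a' + k * E * b"
  have K: "k * K = 1" and E: "e0 * E = 1" using k e0 by (simp_all add: K_def E_def)
  have F: "(a * b - e0) * c + (a^2 + b^2 - T1 * a - T2 * b + T4) = 0"
    using assms(1) by (simp add: mem_CV x)
  have "\<Phi> (twist x) = (X1, X2, C)"
    using Phi_twist[of a b c] assms
    by (simp add: x z1_eq X1_def X2_def C_def K_def E_def a'_def)
  moreover have third: "- C - X2 * X1 + Theta3 e0 e3 e4 k = c"
  proof -
    have "a * a' = b^2 - T2 * b - e0 * c + T4" unfolding a'_def using F by algebra
    then show ?thesis
      unfolding C_def X1_def X2_def Theta_expand K_def[symmetric] E_def[symmetric]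
      unfolding theta_expand using K E by algebra
  qed
  moreover have "- X2 + C * X1 + X2 * X1^2 - Theta3 e0 e3 e4 k * X1 + Theta2 e0 e3 e4 k =
      - E * k * a * c + K * a - E * k * b + par e3 * k + par e4 * E * k"
  proof -
    have "- X2 + C * X1 + X2 * X1^2 - Theta3 e0 e3 e4 k * X1 + Theta2 e0 e3 e4 k =
        - X2 - c * X1 + Theta2 e0 e3 e4 k"
      unfolding third[symmetric] by (simp add: algebra_simps power2_eq_square)
    also have "\<dots> = - E * k * a * c + K * a - E * k * b + par e3 * k + par e4 * E * k"
      unfolding X1_def X2_def a'_def Theta_expand theta_expand K_def[symmetric] E_def[symmetric]
      by (simp add: algebra_simps)
    finally show ?thesis .
  qed
  ultimately show ?thesis
    by (simp add: h23_def x) (simp add: Phi_def X1_def K_def E_def)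
qed

lemma generically_h23_Phi_twist:
  "generically S (\<lambda>x. h23 e0 e3 e4 k (\<Phi> (twist x)) = \<Phi> x)"
  by (rule generically_conj2[OF generically_y2 generically_z1]) (rule h23_Phi_twist)

lemma conj_h23: "conj_Phi e0 e3 e4 k (h23 e0 e3 e4 k) = inv\<^bsub>G\<^esub> cls twist"
proof -
  obtain v where v: "birational_inverse S S twist v"
    using birational_twist unfolding birational_def by blast
  have bv: "birational S S v" using birational_inverse_sym[OF v] unfolding birational_def by blast
  have "generically S (\<lambda>x. twist (v x) = x)" using v by (simp add: birational_inverse_def)
  moreover have "generically S (\<lambda>x. h23 e0 e3 e4 k (\<Phi> (twist (v x))) = \<Phi> (v x))"
    using generically_comp_birational[OF irreducible_CV bv generically_h23_Phi_twist] .
  ultimately have "generically S (\<lambda>x. h23 e0 e3 e4 k (\<Phi> x) = \<Phi> (v x))"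
    by (rule generically_conj2) simp
  from conj_Phi_eq[OF bv this] show ?thesis by (simp add: Bir_inv[OF irreducible_CV v])
qed

text \<open>From \<open>h12 \<circ> \<Phi> \<circ> g = \<Phi>\<close> and \<open>h23 \<circ> \<Phi> \<circ> twist = \<Phi>\<close> one gets \<open>h12 \<circ> h23 \<circ> \<Phi> \<circ> twist \<circ> g = \<Phi>\<close>, and
  \<open>h31\<close> inverts \<open>h12 \<circ> h23\<close>.\<close>

lemma conj_h31: "conj_Phi e0 e3 e4 k (h31 e0 e3 e4 k) = cls twist \<otimes>\<^bsub>G\<^esub> cls (sg1 \<circ> sg2)"
proof -
  have "generically S (\<lambda>x. h23 e0 e3 e4 k (\<Phi> (twist ((sg1 \<circ> sg2) x))) = \<Phi> ((sg1 \<circ> sg2) x))"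
    by (rule generically_comp_birational[OF irreducible_CV birational_g generically_h23_Phi_twist])
  then have "generically S (\<lambda>x. h31 e0 e3 e4 k (\<Phi> x) = \<Phi> ((twist \<circ> (sg1 \<circ> sg2)) x))"
  proof (rule generically_mono)
    fix x assume "h23 e0 e3 e4 k (\<Phi> (twist ((sg1 \<circ> sg2) x))) = \<Phi> ((sg1 \<circ> sg2) x)"
    then have "h12 e0 e3 e4 k (h23 e0 e3 e4 k (\<Phi> (twist ((sg1 \<circ> sg2) x)))) = \<Phi> x"
      using h12_Phi[of "(sg1 \<circ> sg2) x"] by (simp add: sigma1_sigma1 sigma2_sigma2)
    then show "h31 e0 e3 e4 k (\<Phi> x) = \<Phi> ((twist \<circ> (sg1 \<circ> sg2)) x)"
      using h31_h12_h23[of "\<Phi> (twist ((sg1 \<circ> sg2) x))"] by simp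
  qed
  then show ?thesis
    by (simp add: conj_Phi_eq birational_o birational_twist birational_g cls_mult)
qed

end

section \<open>Comparison of the generated groups\<close>

lemma (in group) generate_eqI:
  assumes "A \<subseteq> carrier G" "B \<subseteq> carrier G" "A \<subseteq> generate G B" "B \<subseteq> generate G A"
  shows "generate G A = generate G B"
  using assms by (meson generate_is_subgroup generate_subgroup_incl subset_antisym)

lemma (in group) generate_generate_Un:
  assumes "A \<subseteq> carrier G" "B \<subseteq> carrier G"
  shows "generate G (generate G A \<union> B) = generate G (A \<union> B)"
proof (rule generate_eqI)
  show "generate G A \<union> B \<subseteq> carrier G" using assms generate_incl[of A] by blast
  show "generate G A \<union> B \<subseteq> generate G (A \<union> B)"
    using mono_generate[of A "A \<union> B"] by (auto intro: generate.incl)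
  show "A \<union> B \<subseteq> generate G (generate G A \<union> B)" by (auto intro: generate.incl)
qed (use assms in blast)

text \<open>The group-theoretic core, with \<open>t\<close> and \<open>u\<close> the tori fixing \<open>x\<^sub>1\<close> and \<open>x\<^sub>2\<close>.  Square roots enter because the
  confluent generators contain only the torus elements with parameter \<open>k\<^sup>2 / e\<close>.\<close>

lemma (in group) torus_generation:
  fixes t u :: "complex \<Rightarrow> 'a" and e :: complex
  assumes e: "e \<noteq> 0"
    and carrier: "g \<in> carrier G" "s \<in> carrier G" "m \<in> carrier G" "M \<in> carrier G"
      "\<And>l. l \<noteq> 0 \<Longrightarrow> t l \<in> carrier G" "\<And>l. l \<noteq> 0 \<Longrightarrow> u l \<in> carrier G"
    and t_mult: "\<And>l l'. l \<noteq> 0 \<Longrightarrow> l' \<noteq> 0 \<Longrightarrow> t l \<otimes> t l' = t (l * l')"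
    and s_t: "\<And>l. l \<noteq> 0 \<Longrightarrow> s \<otimes> t l = u l \<otimes> s"
    and m_u: "\<And>l. l \<noteq> 0 \<Longrightarrow> m \<otimes> u l = u l \<otimes> m"
    and M_m: "M \<otimes> m = u e"
  defines "w \<equiv> \<lambda>k. t (k^2 / e) \<otimes> inv s \<otimes> m"
  shows "generate G ((\<Union>k\<in>-{0}. {inv g, inv (w k), w k \<otimes> g}) \<union> {M}) =
    generate G ({g} \<union> {t l |l. l \<noteq> 0} \<union> {s, g \<otimes> inv s \<otimes> m \<otimes> m} \<union> {m})"
    (is "generate G ?A = generate G ?B")
proof (rule generate_eqI)
  note [simp] = carrier
  have w [simp]: "w k \<in> carrier G" if "k \<noteq> 0" for k using that e by (simp add: w_def)
  show A: "?A \<subseteq> carrier G" by auto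
  show B: "?B \<subseteq> carrier G" by auto
  have u: "u l = s \<otimes> t l \<otimes> inv s" if "l \<noteq> 0" for l using s_t[OF that] that inv_solve_right by simp
  show "?A \<subseteq> generate G ?B"
  proof -
    interpret K: subgroup "generate G ?B" G by (rule generate_is_subgroup[OF B])
    have gens: "g \<in> generate G ?B" "s \<in> generate G ?B" "m \<in> generate G ?B"
      "\<And>l. l \<noteq> 0 \<Longrightarrow> t l \<in> generate G ?B"
      by (auto intro: generate.incl)
    then have "u e \<in> generate G ?B" unfolding u[OF e] using e by blast
    moreover have "M = u e \<otimes> inv m" using M_m e by (simp add: inv_solve_right)
    ultimately have "M \<in> generate G ?B" using gens by blast
    moreover have "w k \<in> generate G ?B" if "k \<noteq> 0" for k
      unfolding w_def by (intro K.m_closed K.m_inv_closed gens) (use that e in auto)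
    ultimately show ?thesis using gens by blast
  qed
  show "?B \<subseteq> generate G ?A"
  proof -
    interpret K: subgroup "generate G ?A" G by (rule generate_is_subgroup[OF A])
    let ?K = "generate G ?A"
    have "1 \<in> - {0 :: complex}" by simp
    then have inK: "inv g \<in> ?K" "M \<in> ?K" "\<And>k. k \<noteq> 0 \<Longrightarrow> inv (w k) \<in> ?K"
      by (blast intro: generate.incl)+
    have g: "g \<in> ?K" using K.m_inv_closed[OF inK(1)] by simp
    have wK: "w k \<in> ?K" if "k \<noteq> 0" for k using K.m_inv_closed[OF inK(3)[OF that]] that by simp
    define r where "r = inv s \<otimes> m"
    have r [simp]: "r \<in> carrier G" by (simp add: r_def)
    have w_r: "w k = t (k^2 / e) \<otimes> r" if "k \<noteq> 0" for k
      unfolding w_def r_def by (rule m_assoc) (use that e in auto)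
    have t1: "t 1 = \<one>" using t_mult[of 1 1] l_cancel_one[of "t 1" "t 1"] by simp
    have t: "t l \<in> ?K" if l: "l \<noteq> 0" for l
    proof -
      define k where "k = csqrt (l * e)"
      have k: "k \<noteq> 0" "k^2 / e = l" using l e by (simp_all add: k_def)
      (* with this parameter the torus factor of w is trivial *)
      define k' where "k' = csqrt e"
      have k': "k' \<noteq> 0" "k'^2 / e = 1" using e by (simp_all add: k'_def)
      have "w k \<otimes> inv (w k') = t l"
        using k k' l by (simp add: w_r t1 m_assoc)
      moreover have "w k \<otimes> inv (w k') \<in> ?K" by (intro K.m_closed wK inK k k')
      ultimately show ?thesis by simp
    qed
    have rK: "r \<in> ?K"
    proof -
      define k where "k = csqrt e"
      have "k \<noteq> 0" "k^2 / e = 1" using e by (simp_all add: k_def)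
      then show ?thesis using wK[of k] by (simp add: w_r t1)
    qed
    have "u e \<in> ?K"
    proof -
      have "inv r \<otimes> t e \<otimes> r = inv m \<otimes> (s \<otimes> t e \<otimes> inv s) \<otimes> m"
        using e by (simp add: r_def inv_mult_group m_assoc)
      also have "\<dots> = inv m \<otimes> (m \<otimes> u e)" unfolding u[OF e, symmetric] m_u[OF e] using e by (simp add: m_assoc)
      also have "\<dots> = u e" using e by (simp add: m_assoc[symmetric])
      finally have "u e = inv r \<otimes> t e \<otimes> r" by (rule sym)
      then show ?thesis by (simp only: K.m_closed K.m_inv_closed rK t[OF e])
    qed
    moreover have "m = inv M \<otimes> u e" using M_m[symmetric] e by (simp add: inv_solve_left)
    ultimately have m: "m \<in> ?K" using inK(2) by (simp only: K.m_closed K.m_inv_closed)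
    have "s = m \<otimes> inv r" by (simp add: r_def inv_mult_group m_assoc[symmetric])
    then have "s \<in> ?K" using m rK by (simp only: K.m_closed K.m_inv_closed)
    then have "{s, g \<otimes> inv s \<otimes> m \<otimes> m} \<subseteq> ?K"
      using g m by (simp only: insert_subset K.m_closed K.m_inv_closed) simp
    moreover have "{t l |l. l \<noteq> 0} \<subseteq> ?K" using t by blast
    ultimately show ?thesis using g m by (simp only: Un_subset_iff insert_subset empty_subsetI)
  qed
qed

theorem theorem5p29:
  fixes e0 e3 e4 :: complex
  assumes "e0 \<noteq> 0" and "e3 \<noteq> 0" and "e4 \<noteq> 0"
    and "e0 \<noteq> 1" and "e0 \<noteq> -1"
    and "e3 \<noteq> 1" and "e3 \<noteq> -1"
    and "e4 \<noteq> 1" and "e4 \<noteq> -1"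
    and "\<forall>\<epsilon>3\<in>{1, -1 :: int}. \<forall>\<epsilon>4\<in>{1, -1 :: int}. e0 * e3 powi \<epsilon>3 * e4 powi \<epsilon>4 \<noteq> 1"
  shows "Conf_sharp e0 e3 e4 = Dyn_sharp e0 e3 e4"
proof -
  interpret cubic_surface e0 e3 e4 by unfold_locales (rule assms(1))
  interpret Bir: group G by (rule group_Bir_CV)
  let ?g = "cls (sg1 \<circ> sg2)" and ?s = "cls stokes" and ?m = "cls (scale_y2 e0 (- 2))"
    and ?M = "cls (scale_y2 1 2)"
  let ?w = "\<lambda>k. cls (scale_y1 (k^2 / e0)) \<otimes>\<^bsub>G\<^esub> inv\<^bsub>G\<^esub> ?s \<otimes>\<^bsub>G\<^esub> ?m"
  have carrier: "?g \<in> carrier G" "?s \<in> carrier G" "?m \<in> carrier G" "?M \<in> carrier G"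
    "\<And>l. l \<noteq> 0 \<Longrightarrow> cls (scale_y1 l) \<in> carrier G"
    "\<And>l. l \<noteq> 0 \<Longrightarrow> cls (scale_y2 l 0) \<in> carrier G"
    using e0 by (simp_all add: map_class_in_Bir birational_g birational_stokes birational_scale_y1
        birational_scale_y2)
  have inv_s: "inv\<^bsub>G\<^esub> ?s = cls stokes_inv"
    by (rule Bir_inv[OF irreducible_CV birational_inverse_stokes])
  have "inv\<^bsub>G\<^esub> ?g = cls (sg2 \<circ> sg1)"
    by (rule Bir_inv[OF irreducible_CV birational_inverse_g])
  then have conf: "{conj_Phi e0 e3 e4 k h |h. h \<in> {h12 e0 e3 e4 k, h23 e0 e3 e4 k, h31 e0 e3 e4 k}} =
      {inv\<^bsub>G\<^esub> ?g, inv\<^bsub>G\<^esub> (?w k), ?w k \<otimes>\<^bsub>G\<^esub> ?g}" if k: "k \<noteq> 0" for k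
  proof -
    interpret confluence e0 e3 e4 k by unfold_locales (rule k)
    have "?w k = cls twist"
      unfolding twist_def inv_s using k e0
      by (simp add: cls_mult birational_o birational_scale_y1 birational_scale_y2 birational_stokes_inv)
    then show ?thesis using \<open>inv\<^bsub>G\<^esub> ?g = _\<close> conj_h12 conj_h23 conj_h31 by auto
  qed
  have conf_gens: "{conj_Phi e0 e3 e4 k h |k h. k \<noteq> 0 \<and> h \<in> {h12 e0 e3 e4 k, h23 e0 e3 e4 k, h31 e0 e3 e4 k}}
      = (\<Union>k\<in>-{0}. {inv\<^bsub>G\<^esub> ?g, inv\<^bsub>G\<^esub> (?w k), ?w k \<otimes>\<^bsub>G\<^esub> ?g})"
  proof -
    have "{conj_Phi e0 e3 e4 k h |k h. k \<noteq> 0 \<and> h \<in> {h12 e0 e3 e4 k, h23 e0 e3 e4 k, h31 e0 e3 e4 k}}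
      = (\<Union>k\<in>-{0}. {conj_Phi e0 e3 e4 k h |h. h \<in> {h12 e0 e3 e4 k, h23 e0 e3 e4 k, h31 e0 e3 e4 k}})"
      by blast
    then show ?thesis using conf by simp
  qed
  have w_carrier: "?w k \<in> carrier G" if "k \<noteq> 0" for k using carrier that e0 by simp
  have s2: "s2 e0 e3 e4 = ?g \<otimes>\<^bsub>G\<^esub> inv\<^bsub>G\<^esub> ?s \<otimes>\<^bsub>G\<^esub> ?m \<otimes>\<^bsub>G\<^esub> ?m"
  proof -
    have mm: "cls (scale_y2 (e0 * e0) (- 4)) = ?m \<otimes>\<^bsub>G\<^esub> ?m" using scale_y2_mult[OF e0 e0] by simp
    show ?thesis
      unfolding s2_eq inv_s[symmetric] mm
      by (rule Bir.m_assoc[symmetric]) (intro Bir.m_closed Bir.inv_closed carrier)+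
  qed
  have "Conf_sharp e0 e3 e4 =
      generate G ((\<Union>k\<in>-{0}. {inv\<^bsub>G\<^esub> ?g, inv\<^bsub>G\<^esub> (?w k), ?w k \<otimes>\<^bsub>G\<^esub> ?g}) \<union> {?M})"
    unfolding Conf_sharp_def Conf_def conf_gens scale_y2_z1_y2_eq
    using carrier w_carrier by (intro Bir.generate_generate_Un) auto
  also have "\<dots> = generate G ({?g} \<union> {cls (scale_y1 l) |l. l \<noteq> 0} \<union>
      {?s, ?g \<otimes>\<^bsub>G\<^esub> inv\<^bsub>G\<^esub> ?s \<otimes>\<^bsub>G\<^esub> ?m \<otimes>\<^bsub>G\<^esub> ?m} \<union> {?m})"
  proof (rule Bir.torus_generation[OF e0 carrier])
    fix l :: complex assume "l \<noteq> 0"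
    then show "?m \<otimes>\<^bsub>G\<^esub> cls (scale_y2 l 0) = cls (scale_y2 l 0) \<otimes>\<^bsub>G\<^esub> ?m"
      using e0 by (simp add: scale_y2_mult mult.commute)
  qed (use scale_y2_mult[of 1 e0 2 "-2"] e0 in \<open>simp_all add: scale_y1_mult stokes_scale_y1\<close>)
  also have "\<dots> = Dyn_sharp e0 e3 e4"
    unfolding Dyn_sharp_def Dyn_def g_map_def T_y1_eq s1_eq s2 m_half_eq
    using carrier by (intro Bir.generate_generate_Un[symmetric]) auto
  finally show ?thesis .
qed

end
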